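(* Let $G=(\mathcal{X},\mathcal{A},\mu,V)$ be a $k$-player $\alpha$-anchored game such that $\mathrm{val}(G)\le 1-\varepsilon$. Then for every positive integer $n$, $$\mathrm{val}(G^n)\le \exp\left(-\frac{\alpha^{2k}\cdot\varepsilon^3\cdot n}{384\cdot s\cdot k^2}\right),$$ where $s=\log|\mathcal{A}|$.
   Context: A $k$-player game $G=(\mathcal{X},\mathcal{A},\mu,V)$ consists of finite question sets with $\mathcal{X}=\mathcal{X}^1\times\cdots\times\mathcal{X}^k$, finite answer sets with $\mathcal{A}=\mathcal{A}^1\times\cdots\times\mathcal{A}^k$, a probability measure $\mu$ on $\mathcal{X}$, and a predicate $V:\mathcal{X}\times\mathcal{A}\to\{0,1\}$. The classical value is $\mathrm{val}(G)=\sup_{f^1,\dots,f^k}\mathbb{E}_{x\sim\mu}V(x,(f^1(x^1),\dots,f^k(x^k)))$ over functions $f^t:\mathcal{X}^t\to\mathcal{A}^t$. The $n$-fold parallel repetition $G^n$ is the $k$-player game in which $x_1,\dots,x_n\in\mathcal{X}$ are sampled independently from $\mu$, player $t$ receives $(x_1^t,\dots,x_n^t)$ and answers $(a_1^t,\dots,a_n^t)\in(\mathcal{A}^t)^n$, and the players win iff $V(x_i,a_i)=1$ for all $i\in[n]$, where $a_i=(a_i^1,\dots,a_i^k)$. A $k$-player game is $\alpha$-anchored ($0<\alpha\le1$) if there exist subsets $\mathcal{X}^t_\perp\subseteq\mathcal{X}^t$ ($t\in[k]$) such that (1) for each $t$ the marginal probability under $\mu$ that $x^t\in\mathcal{X}^t_\perp$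 is at least $\alpha$, and (2) for all $x\in\mathcal{X}$, $\mu(x)=\mu(x|_{\overline{F}_x})\prod_{t\in F_x}\mu(x^t)$, where $F_x=\{t\in[k]:x^t\in\mathcal{X}^t_\perp\}$, $\overline{F}_x=[k]\setminus F_x$, $\mu(x|_S)$ is the marginal probability under $\mu$ of the restriction of $x$ to the coordinates in $S$ (equal to $1$ for $S=\emptyset$), and $\mu(x^t)$ is the marginal probability of the $t$-th coordinate. *)

theory Defs
  imports "HOL-Analysis.Analysis"
begin

text \<open>A k-player game: players are indexed by t < k. Player t has question set X t
and answer set A t. A question tuple is an (extensional) function x in PiE {..<k} X,
an answer tuple is a function a in PiE {..<k} A. mu is a probability mass function on
question tuples, V the predicate.\<close>

definition game ::
  "nat \<Rightarrow> (nat \<Rightarrow> 'q set) \<Rightarrow> (nat \<Rightarrow> 'a set) \<Rightarrow> ((nat \<Rightarrow> 'q) \<Rightarrow> real) \<Rightarrow> bool" where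
  "game k X A mu \<longleftrightarrow>
     (\<forall>t<k. finite (X t) \<and> finite (A t) \<and> A t \<noteq> {}) \<and>
     (\<forall>x. 0 \<le> mu x) \<and>
     (\<forall>x. x \<notin> PiE {..<k} X \<longrightarrow> mu x = 0) \<and>
     sum mu (PiE {..<k} X) = 1"

definition strategies :: "nat \<Rightarrow> (nat \<Rightarrow> 'q set) \<Rightarrow> (nat \<Rightarrow> 'a set) \<Rightarrow> (nat \<Rightarrow> 'q \<Rightarrow> 'a) set" where
  "strategies k X A = PiE {..<k} (\<lambda>t. X t \<rightarrow>\<^sub>E A t)"

definition win_prob ::
  "nat \<Rightarrow> (nat \<Rightarrow> 'q set) \<Rightarrow> ((nat \<Rightarrow> 'q) \<Rightarrow> real) \<Rightarrow> ((nat \<Rightarrow> 'q) \<Rightarrow> (nat \<Rightarrow> 'a) \<Rightarrow> bool)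
   \<Rightarrow> (nat \<Rightarrow> 'q \<Rightarrow> 'a) \<Rightarrow> real" where
  "win_prob k X mu V f =
     (\<Sum>x\<in>PiE {..<k} X. mu x * (if V x (\<lambda>t\<in>{..<k}. f t (x t)) then 1 else 0))"

text \<open>Classical value (a supremum over a finite nonempty set of strategy tuples).\<close>
definition val ::
  "nat \<Rightarrow> (nat \<Rightarrow> 'q set) \<Rightarrow> (nat \<Rightarrow> 'a set) \<Rightarrow> ((nat \<Rightarrow> 'q) \<Rightarrow> real)
   \<Rightarrow> ((nat \<Rightarrow> 'q) \<Rightarrow> (nat \<Rightarrow> 'a) \<Rightarrow> bool) \<Rightarrow> real" where
  "val k X A mu V = (SUP f\<in>strategies k X A. win_prob k X mu V f)"

text \<open>n-fold parallel repetition. A question tuple y of G^n assigns to player t the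
vector y t = (x_1^t, ..., x_n^t) (an extensional function on {..<n}); round i question
tuple is (\<lambda>t\<in>{..<k}. y t i).\<close>

definition rep_Q :: "nat \<Rightarrow> (nat \<Rightarrow> 'q set) \<Rightarrow> nat \<Rightarrow> (nat \<Rightarrow> 'q) set" where
  "rep_Q n X t = PiE {..<n} (\<lambda>_. X t)"

definition rep_A :: "nat \<Rightarrow> (nat \<Rightarrow> 'a set) \<Rightarrow> nat \<Rightarrow> (nat \<Rightarrow> 'a) set" where
  "rep_A n A t = PiE {..<n} (\<lambda>_. A t)"

definition rep_mu ::
  "nat \<Rightarrow> nat \<Rightarrow> (nat \<Rightarrow> 'q set) \<Rightarrow> ((nat \<Rightarrow> 'q) \<Rightarrow> real) \<Rightarrow> (nat \<Rightarrow> nat \<Rightarrow> 'q) \<Rightarrow> real" where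
  "rep_mu n k X mu y =
     (if y \<in> PiE {..<k} (rep_Q n X) then (\<Prod>i<n. mu (\<lambda>t\<in>{..<k}. y t i)) else 0)"

definition rep_V ::
  "nat \<Rightarrow> nat \<Rightarrow> ((nat \<Rightarrow> 'q) \<Rightarrow> (nat \<Rightarrow> 'a) \<Rightarrow> bool)
   \<Rightarrow> (nat \<Rightarrow> nat \<Rightarrow> 'q) \<Rightarrow> (nat \<Rightarrow> nat \<Rightarrow> 'a) \<Rightarrow> bool" where
  "rep_V n k V y b = (\<forall>i<n. V (\<lambda>t\<in>{..<k}. y t i) (\<lambda>t\<in>{..<k}. b t i))"

definition val_rep ::
  "nat \<Rightarrow> nat \<Rightarrow> (nat \<Rightarrow> 'q set) \<Rightarrow> (nat \<Rightarrow> 'a set) \<Rightarrow> ((nat \<Rightarrow> 'q) \<Rightarrow> real)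
   \<Rightarrow> ((nat \<Rightarrow> 'q) \<Rightarrow> (nat \<Rightarrow> 'a) \<Rightarrow> bool) \<Rightarrow> real" where
  "val_rep n k X A mu V = val k (rep_Q n X) (rep_A n A) (rep_mu n k X mu) (rep_V n k V)"

definition marg ::
  "nat \<Rightarrow> (nat \<Rightarrow> 'q set) \<Rightarrow> ((nat \<Rightarrow> 'q) \<Rightarrow> real) \<Rightarrow> nat set \<Rightarrow> (nat \<Rightarrow> 'q) \<Rightarrow> real" where
  "marg k X mu S x = (\<Sum>x'\<in>{x'\<in>PiE {..<k} X. \<forall>t\<in>S. x' t = x t}. mu x')"

definition anchored ::
  "nat \<Rightarrow> (nat \<Rightarrow> 'q set) \<Rightarrow> ((nat \<Rightarrow> 'q) \<Rightarrow> real) \<Rightarrow> real \<Rightarrow> bool" where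
  "anchored k X mu \<alpha> \<longleftrightarrow> 0 < \<alpha> \<and> \<alpha> \<le> 1 \<and>
     (\<exists>Xp :: nat \<Rightarrow> 'q set.
        (\<forall>t<k. Xp t \<subseteq> X t) \<and>
        (\<forall>t<k. (\<Sum>x\<in>{x\<in>PiE {..<k} X. x t \<in> Xp t}. mu x) \<ge> \<alpha>) \<and>
        (\<forall>x\<in>PiE {..<k} X.
           let F = {t\<in>{..<k}. x t \<in> Xp t} in
           mu x = marg k X mu ({..<k} - F) x * (\<Prod>t\<in>F. marg k X mu {t} x)))"

end

theory Submission
  imports Defs
begin

text \<open>Fix a strategy for the repeated game and a set \<open>C\<close> of rounds, and condition on winning all rounds
  of \<open>C\<close>. In every other round \<open>l\<close> reveal all questions but that of one player \<open>D l\<close>, and reveal also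
  the questions and answers of \<open>C\<close>. Given this information the players are independent, and by a
  relative entropy count over all rounds the conditioned law of the hidden question of a typical
  round \<open>i\<close> is close to its law under \<open>mu\<close> given the other questions of that round. Averaging over
  \<open>D\<close>, the joint law of the questions of round \<open>i\<close> and of the information \<open>r\<close> about the other
  rounds is almost invariant under each step of the Gibbs sampler of \<open>mu\<close>.

  Anchoring enters only here: an anchor question is independent of the questions of all other players,
  so one sweep of the sampler satisfies Doeblin's condition with constant \<open>\<alpha>\<^sup>k\<close>. An almost invariant
  law is therefore close to the product of \<open>mu\<close> and the law of \<open>r\<close>. The players can thus draw \<open>r\<close>
  from shared randomness, independently of their questions, and simulate round \<open>i\<close>; hence the
  conditional probability of winning it hardly exceeds the value of the game. Adding such rounds to
  \<open>C\<close> one by one gives the exponential decay.\<close>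

section \<open>Entropy inequalities\<close>

text \<open>Jensen's inequality for the logarithm with an unnormalised \<open>b\<close>:
  \<open>ln z \<le> z - 1\<close> is applied to \<open>b x / q x\<close> divided by
  \<open>sum b S\<close>, so that the linear bounds sum to 0.\<close>

lemma sum_mult_ln_ratio_le:
  fixes q b :: "'a \<Rightarrow> real"
  assumes fin: "finite S" and q: "\<And>x. x \<in> S \<Longrightarrow> 0 < q x" and b: "\<And>x. x \<in> S \<Longrightarrow> 0 < b x"
    and sq: "sum q S = 1" and sb: "sum b S \<le> B"
  shows "(\<Sum>x\<in>S. q x * ln (b x / q x)) \<le> ln B"
proof -
  have "S \<noteq> {}" using sq by auto
  hence s: "0 < sum b S" using fin b by (simp add: sum_pos)
  have "(\<Sum>x\<in>S. q x * (ln (b x / q x) - ln (sum b S))) \<le> (\<Sum>x\<in>S. b x / sum b S - q x)"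
  proof (rule sum_mono)
    fix x assume x: "x \<in> S"
    have "ln (b x / q x) - ln (sum b S) = ln (b x / q x / sum b S)"
      using q[OF x] b[OF x] s by (simp add: ln_div ln_mult)
    also have "\<dots> \<le> b x / q x / sum b S - 1"
      using q[OF x] b[OF x] s by (intro ln_le_minus_one) simp
    finally have "q x * (ln (b x / q x) - ln (sum b S)) \<le> q x * (b x / q x / sum b S - 1)"
      using q[OF x] by (intro mult_left_mono) auto
    also have "\<dots> = b x / sum b S - q x" using q[OF x] s by (simp add: field_simps)
    finally show "q x * (ln (b x / q x) - ln (sum b S)) \<le> b x / sum b S - q x" .
  qed
  also have "\<dots> = 0" using s by (simp add: sum_subtractf sq flip: sum_divide_distrib)
  finally have "(\<Sum>x\<in>S. q x * ln (b x / q x)) \<le> ln (sum b S)"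
    by (simp add: right_diff_distrib sum_subtractf sq flip: sum_distrib_right)
  also have "\<dots> \<le> ln B" using s sb by simp
  finally show ?thesis .
qed

text \<open>Pinsker's inequality up to a constant, through the Hellinger distance: the Kullback-Leibler
  divergence dominates the sum of the \<open>(\<surd>p - \<surd>q)\<^sup>2\<close>.\<close>

lemma L1_sq_le_KL:
  fixes p q :: "'a \<Rightarrow> real"
  assumes fin: "finite S" and p: "\<And>x. x \<in> S \<Longrightarrow> 0 \<le> p x" and q: "\<And>x. x \<in> S \<Longrightarrow> 0 \<le> q x"
    and pq: "\<And>x. x \<in> S \<Longrightarrow> 0 < p x \<Longrightarrow> 0 < q x" and sp: "sum p S = 1" and sq: "sum q S \<le> 1"
  shows "(\<Sum>x\<in>S. \<bar>p x - q x\<bar>)\<^sup>2 \<le> 4 * (\<Sum>x\<in>S. p x * ln (p x / q x))"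
proof -
  let ?H = "\<Sum>x\<in>S. (sqrt (p x) - sqrt (q x))\<^sup>2"
  have "?H = (\<Sum>x\<in>S. p x + q x - 2 * sqrt (p x) * sqrt (q x))"
    using p q by (intro sum.cong refl) (simp add: power2_diff)
  also have "\<dots> \<le> (\<Sum>x\<in>S. q x - p x + p x * ln (p x / q x))"
  proof (rule sum_mono)
    fix x assume x: "x \<in> S"
    show "p x + q x - 2 * sqrt (p x) * sqrt (q x) \<le> q x - p x + p x * ln (p x / q x)"
    proof (cases "p x = 0")
      case False
      hence px: "0 < p x" using p[OF x] by simp
      have qx: "0 < q x" using pq[OF x px] .
      \<comment> \<open>Writing the logarithm as twice that of a square root before bounding it by
        \<open>z - 1\<close> is what produces the Hellinger distance.\<close>
      have "ln (p x / q x) = - 2 * ln (sqrt (q x / p x))"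
        using px qx by (simp add: ln_sqrt ln_div)
      moreover have "ln (sqrt (q x / p x)) \<le> sqrt (q x / p x) - 1"
        using px qx by (intro ln_le_minus_one) simp
      ultimately have "2 * (1 - sqrt (q x / p x)) \<le> ln (p x / q x)" by simp
      hence "p x * (2 * (1 - sqrt (q x / p x))) \<le> p x * ln (p x / q x)"
        using px by (intro mult_left_mono) auto
      moreover have "p x * sqrt (q x / p x) = sqrt (p x) * sqrt (q x)"
        using px real_sqrt_mult_self[of "p x"]
        by (simp add: real_sqrt_divide field_simps del: real_sqrt_mult_self)
      ultimately show ?thesis by (simp add: algebra_simps)
    qed simp
  qed
  also have "\<dots> \<le> (\<Sum>x\<in>S. p x * ln (p x / q x))"
    using sp sq by (simp add: sum.distrib sum_subtractf)
  finally have H: "?H \<le> (\<Sum>x\<in>S. p x * ln (p x / q x))" .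
  \<comment> \<open>Factoring \<open>p - q\<close> over the square roots lets Cauchy-Schwarz split
    off the Hellinger distance; the other factor is at most 4 because both total masses are at most
    1.\<close>
  have "(\<Sum>x\<in>S. \<bar>p x - q x\<bar>) = (\<Sum>x\<in>S. \<bar>sqrt (p x) - sqrt (q x)\<bar> * (sqrt (p x) + sqrt (q x)))"
  proof (intro sum.cong refl)
    fix x assume x: "x \<in> S"
    have "p x - q x = (sqrt (p x) - sqrt (q x)) * (sqrt (p x) + sqrt (q x))"
      using p[OF x] q[OF x] by (simp add: algebra_simps)
    thus "\<bar>p x - q x\<bar> = \<bar>sqrt (p x) - sqrt (q x)\<bar> * (sqrt (p x) + sqrt (q x))"
      using p[OF x] q[OF x] by (simp add: abs_mult)
  qed
  hence "(\<Sum>x\<in>S. \<bar>p x - q x\<bar>)\<^sup>2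
      \<le> (\<Sum>x\<in>S. \<bar>sqrt (p x) - sqrt (q x)\<bar>\<^sup>2) * (\<Sum>x\<in>S. (sqrt (p x) + sqrt (q x))\<^sup>2)"
    by (simp only: Cauchy_Schwarz_ineq_sum)
  also have "\<dots> \<le> ?H * 4"
  proof (intro mult_mono)
    have "(\<Sum>x\<in>S. (sqrt (p x) + sqrt (q x))\<^sup>2) \<le> (\<Sum>x\<in>S. 2 * (p x + q x))"
    proof (rule sum_mono)
      fix x assume x: "x \<in> S"
      have "0 \<le> (sqrt (p x) - sqrt (q x))\<^sup>2" by simp
      thus "(sqrt (p x) + sqrt (q x))\<^sup>2 \<le> 2 * (p x + q x)"
        using p[OF x] q[OF x] by (simp add: power2_diff power2_sum)
    qed
    also have "\<dots> = 2 * (sum p S + sum q S)" by (simp add: sum.distrib flip: sum_distrib_left)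
    also have "\<dots> \<le> 4" using sp sq by simp
    finally show "(\<Sum>x\<in>S. (sqrt (p x) + sqrt (q x))\<^sup>2) \<le> 4" .
  qed (auto intro: sum_nonneg)
  finally show ?thesis using H by simp
qed

section \<open>A recursion over subsets\<close>

lemma sum_Pow_prod:
  fixes r :: "'a \<Rightarrow> real"
  assumes "finite T"
  shows "(\<Sum>U\<in>Pow T. \<Prod>t\<in>U. r t) = (\<Prod>t\<in>T. 1 + r t)"
  using prod_add[OF assms, of r "\<lambda>_. 1"] by (simp add: add.commute)

text \<open>For a random subset of \<open>T\<close> with \<open>e U\<close> the probability of \<open>U\<close>, the hypothesis on \<open>e\<close> forces the
  elements to be present independently with probabilities \<open>a t\<close>.\<close>

lemma subset_recursion_product:
  fixes a :: "'a \<Rightarrow> real" and e :: "'a set \<Rightarrow> real"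
  assumes T: "finite T" and a: "\<And>t. t \<in> T \<Longrightarrow> 0 \<le> a t \<and> a t < 1"
    and e: "\<And>U. U \<subseteq> T \<Longrightarrow> e U = (\<Prod>t\<in>U. a t) * (\<Sum>U'\<in>Pow U. e U')"
    and U: "U \<subseteq> T"
  shows "e U = e {} * (\<Prod>t\<in>U. a t / (1 - a t))"
  using finite_subset[OF U T] U
proof (induction U rule: finite_psubset_induct)
  case (psubset U)
  let ?r = "\<lambda>t. a t / (1 - a t)"
  show ?case
  proof (cases "U = {}")
    case False
    have ar: "a t * (1 + ?r t) = ?r t" if "t \<in> U" for t
      using a[of t] that psubset.prems by (auto simp: field_simps)
    \<comment> \<open>The recursion contains \<open>e U\<close> on both sides; it can be solved for
      \<open>e U\<close> because the coefficient \<open>1 - (\<Prod>t\<in>U. a t)\<close> is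
      nonzero.\<close>
    have "(\<Prod>t\<in>U. a t) < 1"
    proof -
      obtain t where t: "t \<in> U" using False by blast
      have "(\<Prod>t\<in>U. a t) = a t * (\<Prod>t\<in>U - {t}. a t)" using psubset.hyps t by (simp add: prod.remove)
      also have "\<dots> \<le> a t * 1"
        using a t psubset.prems by (intro mult_left_mono prod_le_1) (auto intro: less_imp_le)
      finally show ?thesis using a[of t] t psubset.prems by auto
    qed
    have split: "Pow U = insert U {U'. U' \<subset> U}" by auto
    have fin: "finite {U'. U' \<subset> U}"
      by (rule finite_subset[of _ "Pow U"]) (use psubset.hyps in auto)
    have "(\<Sum>U'\<in>Pow U. \<Prod>t\<in>U'. ?r t) = (\<Prod>t\<in>U. ?r t) + (\<Sum>U' | U' \<subset> U. \<Prod>t\<in>U'. ?r t)"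
      unfolding split using fin by (subst sum.insert) auto
    hence S: "(\<Sum>U' | U' \<subset> U. \<Prod>t\<in>U'. ?r t) = (\<Prod>t\<in>U. 1 + ?r t) - (\<Prod>t\<in>U. ?r t)"
      using sum_Pow_prod[of U ?r] psubset.hyps by simp
    have "(\<Sum>U'\<in>Pow U. e U') = e U + (\<Sum>U' | U' \<subset> U. e U')"
      unfolding split using fin by (subst sum.insert) auto
    also have "(\<Sum>U' | U' \<subset> U. e U') = e {} * (\<Sum>U' | U' \<subset> U. \<Prod>t\<in>U'. ?r t)"
      unfolding sum_distrib_left using psubset by (intro sum.cong refl) auto
    finally have "e U = (\<Prod>t\<in>U. a t) * (e U + e {} * ((\<Prod>t\<in>U. 1 + ?r t) - (\<Prod>t\<in>U. ?r t)))"
      using e[OF psubset.prems] S by simp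
    also have "\<dots> = (\<Prod>t\<in>U. a t) * e U + e {} * ((\<Prod>t\<in>U. a t * (1 + ?r t)) - (\<Prod>t\<in>U. a t) * (\<Prod>t\<in>U. ?r t))"
      unfolding prod.distrib by (simp add: algebra_simps)
    also have "(\<Prod>t\<in>U. a t * (1 + ?r t)) = (\<Prod>t\<in>U. ?r t)" using ar by (intro prod.cong) auto
    finally have "(1 - (\<Prod>t\<in>U. a t)) * (e U - e {} * (\<Prod>t\<in>U. ?r t)) = 0" by (simp add: algebra_simps)
    thus ?thesis using \<open>(\<Prod>t\<in>U. a t) < 1\<close> by simp
  qed simp
qed

text \<open>By the product form, the sum over \<open>Pow S\<close> is \<open>e {}\<close> times the
  product of \<open>1 / (1 - a t)\<close> over \<open>S\<close>, and dropping \<open>j\<close> loses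
  one factor. In the picture of a random subset, \<open>j\<close> is absent with probability
  \<open>1 - a j\<close>.\<close>

lemma subset_recursion_remove_less_one:
  fixes a :: "'a \<Rightarrow> real" and e :: "'a set \<Rightarrow> real"
  assumes T: "finite T" and a: "\<And>t. t \<in> T \<Longrightarrow> 0 \<le> a t \<and> a t < 1"
    and e: "\<And>U. U \<subseteq> T \<Longrightarrow> e U = (\<Prod>t\<in>U. a t) * (\<Sum>U'\<in>Pow U. e U')"
    and j: "j \<in> T"
  shows "(\<Sum>U\<in>Pow (T - {j}). e U) = (1 - a j) * (\<Sum>U\<in>Pow T. e U)"
proof -
  have *: "(\<Sum>U\<in>Pow S. e U) = e {} * (\<Prod>t\<in>S. 1 + a t / (1 - a t))" if "S \<subseteq> T" for S
  proof -
    have "(\<Sum>U\<in>Pow S. e U) = e {} * (\<Sum>U\<in>Pow S. \<Prod>t\<in>U. a t / (1 - a t))"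
      unfolding sum_distrib_left using that
      by (intro sum.cong refl subset_recursion_product[OF T a e]) auto
    thus ?thesis using sum_Pow_prod[of S] finite_subset[OF that T] by simp
  qed
  have "(\<Prod>t\<in>T. 1 + a t / (1 - a t)) = (1 + a j / (1 - a j)) * (\<Prod>t\<in>T - {j}. 1 + a t / (1 - a t))"
    using T j by (simp add: prod.remove)
  moreover have "(1 - a j) * (1 + a j / (1 - a j)) = 1" using a[OF j] by (simp add: field_simps)
  ultimately have "(\<Prod>t\<in>T - {j}. 1 + a t / (1 - a t)) = (1 - a j) * (\<Prod>t\<in>T. 1 + a t / (1 - a t))"
    by (simp flip: mult.assoc)
  thus ?thesis using *[of T] *[of "T - {j}"] by auto
qed

text \<open>For \<open>a t = 1\<close> the odds \<open>a t / (1 - a t)\<close> are infinite. By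
  \<open>e1\<close> all weight sits on sets containing the set \<open>B\<close> of these elements,
  so for \<open>j\<close> outside \<open>B\<close> the previous lemma is applied to
  \<open>e (U \<union> B)\<close> on \<open>T - B\<close>.\<close>

lemma subset_recursion_remove:
  fixes a :: "'a \<Rightarrow> real" and e :: "'a set \<Rightarrow> real"
  assumes T: "finite T" and a: "\<And>t. t \<in> T \<Longrightarrow> 0 \<le> a t \<and> a t \<le> 1"
    and e: "\<And>U. U \<subseteq> T \<Longrightarrow> e U = (\<Prod>t\<in>U. a t) * (\<Sum>U'\<in>Pow U. e U')"
    and e1: "\<And>t U. t \<in> T \<Longrightarrow> a t = 1 \<Longrightarrow> U \<subseteq> T \<Longrightarrow> t \<notin> U \<Longrightarrow> e U = 0"
    and j: "j \<in> T"
  shows "(\<Sum>U\<in>Pow (T - {j}). e U) = (1 - a j) * (\<Sum>U\<in>Pow T. e U)"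
proof (cases "a j = 1")
  case True
  have "(\<Sum>U\<in>Pow (T - {j}). e U) = 0"
    using e1[OF j True] by (intro sum.neutral) auto
  thus ?thesis using True by simp
next
  case False
  define B where "B = {t\<in>T. a t = 1}"
  have B: "B \<subseteq> T" "finite B" using T by (auto simp: B_def)
  have aB: "(\<Prod>t\<in>B. a t) = 1" by (intro prod.neutral) (auto simp: B_def)
  have shift: "(\<Sum>U\<in>Pow S. e (U \<union> B)) = (\<Sum>U\<in>Pow (S \<union> B). e U)" if S: "S \<subseteq> T - B" for S
  proof -
    have "(\<Sum>U\<in>Pow (S \<union> B). e U) = (\<Sum>U\<in>(\<lambda>U. U \<union> B) ` Pow S. e U)"
    proof (rule sum.mono_neutral_right)
      show "\<forall>U\<in>Pow (S \<union> B) - (\<lambda>U. U \<union> B) ` Pow S. e U = 0"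
      proof
        fix U assume U: "U \<in> Pow (S \<union> B) - (\<lambda>U. U \<union> B) ` Pow S"
        have "\<not> B \<subseteq> U"
        proof
          assume "B \<subseteq> U"
          hence "U = (U - B) \<union> B" "U - B \<in> Pow S" using U by auto
          thus False using U by blast
        qed
        then obtain t where "t \<in> B" "t \<notin> U" by blast
        thus "e U = 0" using e1[of t U] U S B by (auto simp: B_def)
      qed
    qed (use S B T in \<open>auto intro: finite_subset\<close>)
    also have "\<dots> = (\<Sum>U\<in>Pow S. e (U \<union> B))"
    proof (subst sum.reindex)
      show "inj_on (\<lambda>U. U \<union> B) (Pow S)" using S by (auto simp: inj_on_def)
    qed simp
    finally show ?thesis by simp
  qed
  have "(\<Sum>U\<in>Pow (T - B - {j}). e (U \<union> B)) = (1 - a j) * (\<Sum>U\<in>Pow (T - B). e (U \<union> B))"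
  proof (rule subset_recursion_remove_less_one)
    fix U assume U: "U \<subseteq> T - B"
    have "e (U \<union> B) = (\<Prod>t\<in>U \<union> B. a t) * (\<Sum>U'\<in>Pow (U \<union> B). e U')"
      by (rule e) (use U B in auto)
    also have "(\<Prod>t\<in>U \<union> B. a t) = (\<Prod>t\<in>U. a t) * (\<Prod>t\<in>B. a t)"
      using U B T by (intro prod.union_disjoint) (auto intro: finite_subset)
    finally show "e (U \<union> B) = (\<Prod>t\<in>U. a t) * (\<Sum>U'\<in>Pow U. e (U' \<union> B))"
      using shift[OF U] aB by simp
  next
    show "j \<in> T - B" using j False by (simp add: B_def)
  qed (use T a in \<open>auto simp: B_def order.strict_iff_order\<close>)
  moreover have "T - B \<union> B = T" "T - B - {j} \<union> B = T - {j}" using B j False by (auto simp: B_def)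
  ultimately show ?thesis using shift[of "T - B"] shift[of "T - B - {j}"] by auto
qed

section \<open>The Gibbs sampler of an anchored game\<close>

locale finite_game =
  fixes k :: nat and X :: "nat \<Rightarrow> 'q set" and A :: "nat \<Rightarrow> 'a set" and mu :: "(nat \<Rightarrow> 'q) \<Rightarrow> real"
  assumes game: "game k X A mu"
begin

abbreviation Q where "Q \<equiv> PiE {..<k} X"

lemma finite_X: "t < k \<Longrightarrow> finite (X t)"
  and finite_A: "t < k \<Longrightarrow> finite (A t)"
  and A_nonempty: "t < k \<Longrightarrow> A t \<noteq> {}"
  and mu_nonneg: "0 \<le> mu x"
  and sum_mu: "sum mu Q = 1"
  using game by (auto simp: game_def)

lemma finite_Q: "finite Q"
  by (intro finite_PiE) (auto simp: finite_X)

definition slice :: "nat \<Rightarrow> (nat \<Rightarrow> 'q) \<Rightarrow> (nat \<Rightarrow> 'q) set" where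
  "slice t x = {x'\<in>Q. \<forall>s\<in>{..<k} - {t}. x' s = x s}"

abbreviation marg_compl :: "nat \<Rightarrow> (nat \<Rightarrow> 'q) \<Rightarrow> real" where
  "marg_compl t x \<equiv> marg k X mu ({..<k} - {t}) x"

definition marg_single :: "nat \<Rightarrow> 'q \<Rightarrow> real" where
  "marg_single t u = (\<Sum>x | x \<in> Q \<and> x t = u. mu x)"

lemma marg_compl_eq: "marg_compl t x = sum mu (slice t x)"
  by (simp add: marg_def slice_def)

lemma finite_slice: "finite (slice t x)"
  using finite_Q by (auto simp: slice_def)

lemma slice_subset: "slice t x \<subseteq> Q"
  by (auto simp: slice_def)

lemma slice_refl: "x \<in> Q \<Longrightarrow> x \<in> slice t x"
  by (auto simp: slice_def)

lemma slice_eq: "y \<in> slice t x \<Longrightarrow> slice t y = slice t x"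
  by (auto simp: slice_def)

text \<open>Masking coordinate \<open>t\<close> packs the remaining coordinates into one value; this
  is the form in which a row with a hidden entry is revealed later.\<close>

lemma mem_slice_iff:
  assumes "x \<in> Q" "t < k"
  shows "y \<in> slice t x \<longleftrightarrow> y \<in> Q \<and> y(t := undefined) = x(t := undefined)"
proof -
  have "(\<forall>s\<in>{..<k} - {t}. y s = x s) \<longleftrightarrow> y(t := undefined) = x(t := undefined)" if "y \<in> Q"
  proof
    assume *: "\<forall>s\<in>{..<k} - {t}. y s = x s"
    show "y(t := undefined) = x(t := undefined)"
    proof
      fix s show "(y(t := undefined)) s = (x(t := undefined)) s"
        using * that assms by (cases "s < k") (auto simp: PiE_iff extensional_def)
    qed
  qed (auto simp: fun_eq_iff split: if_splits)
  thus ?thesis by (auto simp: slice_def)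
qed

lemma marg_nonneg: "0 \<le> marg k X mu S x"
  by (simp add: marg_def sum_nonneg mu_nonneg)

lemma mu_le_marg_compl: "x \<in> Q \<Longrightarrow> mu x \<le> marg_compl t x"
  unfolding marg_compl_eq using finite_slice slice_refl by (auto intro: member_le_sum mu_nonneg)

lemma marg_single_nonneg: "0 \<le> marg_single t u"
  by (simp add: marg_single_def sum_nonneg mu_nonneg)

lemma marg_singleton: "marg k X mu {t} x = marg_single t (x t)"
  by (simp add: marg_def marg_single_def)

lemma sum_marg_single:
  assumes "finite S"
  shows "(\<Sum>u\<in>S. marg_single t u) = (\<Sum>x | x \<in> Q \<and> x t \<in> S. mu x)"
proof -
  have "(\<Sum>u\<in>S. marg_single t u) = (\<Sum>u\<in>S. \<Sum>x | x \<in> {x\<in>Q. x t \<in> S} \<and> x t = u. mu x)"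
    unfolding marg_single_def by (intro sum.cong refl) auto
  also have "\<dots> = (\<Sum>x | x \<in> Q \<and> x t \<in> S. mu x)"
    using assms finite_Q by (intro sum.group) auto
  finally show ?thesis .
qed

text \<open>Absolute continuity with respect to \<open>mu\<close>. Division by zero makes a Gibbs
  step erase mass on slices that \<open>mu\<close> does not charge; this condition excludes such
  mass.\<close>

definition supported :: "((nat \<Rightarrow> 'q) \<Rightarrow> real) \<Rightarrow> bool" where
  "supported \<phi> \<longleftrightarrow> (\<forall>x\<in>Q. mu x = 0 \<longrightarrow> \<phi> x = 0)"

text \<open>One step of the Gibbs sampler: coordinate \<open>t\<close> is drawn afresh given all other coordinates.\<close>

definition resample :: "nat \<Rightarrow> ((nat \<Rightarrow> 'q) \<Rightarrow> real) \<Rightarrow> (nat \<Rightarrow> 'q) \<Rightarrow> real" where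
  "resample t \<phi> x = mu x / marg_compl t x * sum \<phi> (slice t x)"

definition L1 :: "((nat \<Rightarrow> 'q) \<Rightarrow> real) \<Rightarrow> real" where
  "L1 \<phi> = (\<Sum>x\<in>Q. \<bar>\<phi> x\<bar>)"

lemma supported_resample: "supported (resample t \<phi>)"
  by (simp add: supported_def resample_def)

lemma resample_cong: "(\<And>x. x \<in> Q \<Longrightarrow> \<phi> x = \<psi> x) \<Longrightarrow> resample t \<phi> = resample t \<psi>"
  by (auto simp: resample_def fun_eq_iff slice_def intro!: sum.cong)

lemma resample_diff: "resample t (\<lambda>x. \<phi> x - \<psi> x) = (\<lambda>x. resample t \<phi> x - resample t \<psi> x)"
  by (simp add: resample_def sum_subtractf right_diff_distrib diff_divide_distrib fun_eq_iff)

lemma resample_nonneg: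
  "(\<And>x. x \<in> Q \<Longrightarrow> 0 \<le> \<phi> x) \<Longrightarrow> 0 \<le> resample t \<phi> x"
  unfolding resample_def using slice_subset[of t x]
  by (intro mult_nonneg_nonneg divide_nonneg_nonneg sum_nonneg mu_nonneg marg_nonneg) auto

text \<open>Stationarity of \<open>mu\<close>, up to a factor, under the Gibbs step. If the slice of
  \<open>x\<close> has mass 0, so has \<open>x\<close>, and division by zero does no harm.\<close>

lemma resample_mu:
  assumes "x \<in> Q"
  shows "resample t (\<lambda>x. mu x * c) x = mu x * c"
proof (cases "marg_compl t x = 0")
  case True
  thus ?thesis using mu_le_marg_compl[OF assms, of t] mu_nonneg[of x] by (simp add: resample_def)
next
  case False
  thus ?thesis by (simp add: resample_def marg_compl_eq flip: sum_distrib_right)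
qed

text \<open>Mass is redistributed within each slice by weights \<open>mu x / marg_compl t x\<close>
  that add up to 1; where \<open>marg_compl\<close> is 0, \<open>\<phi>\<close> vanishes by
  \<open>supported\<close>.\<close>

lemma sum_resample:
  assumes "supported \<phi>"
  shows "sum (resample t \<phi>) Q = sum \<phi> Q"
proof -
  have "sum (resample t \<phi>) Q = (\<Sum>x\<in>Q. \<Sum>x' | x' \<in> Q \<and> x' \<in> slice t x. mu x / marg_compl t x * \<phi> x')"
    unfolding resample_def sum_distrib_left using slice_subset
    by (intro sum.cong refl) auto
  also have "\<dots> = (\<Sum>x'\<in>Q. \<Sum>x | x \<in> Q \<and> x' \<in> slice t x. mu x / marg_compl t x * \<phi> x')"
    using finite_Q by (intro sum.swap_restrict)
  also have "\<dots> = (\<Sum>x'\<in>Q. \<phi> x')"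
  proof (intro sum.cong refl)
    fix x' assume x': "x' \<in> Q"
    have "(\<Sum>x | x \<in> Q \<and> x' \<in> slice t x. mu x / marg_compl t x * \<phi> x')
        = (\<Sum>x\<in>slice t x'. mu x / marg_compl t x' * \<phi> x')"
      using x' by (intro sum.cong) (auto simp: marg_compl_eq dest: slice_eq simp: slice_def)
    also have "\<dots> = marg_compl t x' / marg_compl t x' * \<phi> x'"
      by (simp add: marg_compl_eq flip: sum_distrib_right sum_divide_distrib)
    also have "\<dots> = \<phi> x'"
    proof (cases "marg_compl t x' = 0")
      case True
      hence "mu x' = 0" using mu_le_marg_compl[OF x', of t] mu_nonneg[of x'] by simp
      thus ?thesis using assms x' by (simp add: supported_def)
    qed simp
    finally show "(\<Sum>x | x \<in> Q \<and> x' \<in> slice t x. mu x / marg_compl t x * \<phi> x') = \<phi> x'" .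
  qed
  finally show ?thesis .
qed

text \<open>The absolute value moves inside the slice sum, and the mass of
  \<open>\<bar>\<phi> x\<bar>\<close> is preserved, as for any Markov kernel.\<close>

lemma L1_resample_le:
  assumes "supported \<phi>"
  shows "L1 (resample t \<phi>) \<le> L1 \<phi>"
proof -
  have "L1 (resample t \<phi>) \<le> sum (resample t (\<lambda>x. \<bar>\<phi> x\<bar>)) Q"
    unfolding L1_def
  proof (rule sum_mono)
    fix x
    show "\<bar>resample t \<phi> x\<bar> \<le> resample t (\<lambda>x. \<bar>\<phi> x\<bar>) x"
      unfolding resample_def
      by (simp add: abs_mult marg_nonneg mu_nonneg mult_left_mono divide_right_mono sum_abs)
  qed
  also have "\<dots> = L1 \<phi>"
    using assms by (simp add: sum_resample supported_def L1_def)
  finally show ?thesis .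
qed

fun sweep :: "nat \<Rightarrow> ((nat \<Rightarrow> 'q) \<Rightarrow> real) \<Rightarrow> (nat \<Rightarrow> 'q) \<Rightarrow> real" where
  "sweep 0 \<phi> = \<phi>"
| "sweep (Suc j) \<phi> = resample j (sweep j \<phi>)"

lemma supported_sweep: "supported \<phi> \<Longrightarrow> supported (sweep j \<phi>)"
  by (cases j) (auto simp: supported_resample)

lemma sum_sweep: "supported \<phi> \<Longrightarrow> sum (sweep j \<phi>) Q = sum \<phi> Q"
  by (induction j) (auto simp: sum_resample supported_sweep)

lemma sweep_diff: "sweep j (\<lambda>x. \<phi> x - \<psi> x) = (\<lambda>x. sweep j \<phi> x - sweep j \<psi> x)"
  by (induction j) (auto simp: resample_diff)

lemma sweep_nonneg:
  "(\<And>x. x \<in> Q \<Longrightarrow> 0 \<le> \<phi> x) \<Longrightarrow> x \<in> Q \<Longrightarrow> 0 \<le> sweep j \<phi> x"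
  by (induction j arbitrary: x) (auto intro: resample_nonneg)

lemma sweep_mu: "x \<in> Q \<Longrightarrow> sweep j (\<lambda>x. mu x * c) x = mu x * c"
proof (induction j arbitrary: x)
  case (Suc j)
  have "resample j (sweep j (\<lambda>x. mu x * c)) = resample j (\<lambda>x. mu x * c)"
    by (rule resample_cong) (rule Suc.IH)
  thus ?case using Suc.prems by (simp add: resample_mu)
qed simp

lemma L1_triangle: "L1 (\<lambda>x. \<phi> x - \<rho> x) \<le> L1 (\<lambda>x. \<phi> x - \<psi> x) + L1 (\<lambda>x. \<psi> x - \<rho> x)"
  unfolding L1_def sum.distrib[symmetric] by (rule sum_mono) auto

text \<open>Telescoping: since step \<open>j\<close> contracts \<open>L1\<close>, the error
  collected before it passes through it without growth.\<close>

lemma L1_diff_sweep_le: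
  assumes "supported \<phi>"
  shows "L1 (\<lambda>x. \<phi> x - sweep j \<phi> x) \<le> (\<Sum>t<j. L1 (\<lambda>x. \<phi> x - resample t \<phi> x))"
proof (induction j)
  case (Suc j)
  have "L1 (\<lambda>x. \<phi> x - sweep (Suc j) \<phi> x)
      \<le> L1 (\<lambda>x. \<phi> x - resample j \<phi> x) + L1 (\<lambda>x. resample j \<phi> x - sweep (Suc j) \<phi> x)"
    by (rule L1_triangle)
  also have "L1 (\<lambda>x. resample j \<phi> x - sweep (Suc j) \<phi> x) = L1 (resample j (\<lambda>x. \<phi> x - sweep j \<phi> x))"
    by (simp add: resample_diff)
  also have "\<dots> \<le> L1 (\<lambda>x. \<phi> x - sweep j \<phi> x)"
    using assms supported_sweep[OF assms, of j] by (intro L1_resample_le) (auto simp: supported_def)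
  finally show ?case using Suc by simp
qed (simp add: L1_def)

end

section \<open>Independence of anchor questions and contraction of a sweep\<close>

locale anchored_game = finite_game k X A mu
  for k :: nat and X :: "nat \<Rightarrow> 'q set" and A :: "nat \<Rightarrow> 'a set" and mu :: "(nat \<Rightarrow> 'q) \<Rightarrow> real" +
  fixes \<alpha> :: real and Xp :: "nat \<Rightarrow> 'q set"
  assumes alpha: "0 < \<alpha>" "\<alpha> \<le> 1"
    and Xp: "\<And>t. t < k \<Longrightarrow> Xp t \<subseteq> X t"
    and anchor_prob: "\<And>t. t < k \<Longrightarrow> \<alpha> \<le> (\<Sum>x | x \<in> PiE {..<k} X \<and> x t \<in> Xp t. mu x)"
    and anchor_prod: "\<And>x. x \<in> PiE {..<k} X \<Longrightarrow>
      mu x = marg k X mu ({..<k} - {t\<in>{..<k}. x t \<in> Xp t}) x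
        * (\<Prod>t\<in>{t\<in>{..<k}. x t \<in> Xp t}. marg k X mu {t} x)"
begin

definition anchors :: "(nat \<Rightarrow> 'q) \<Rightarrow> nat set" where
  "anchors x = {t\<in>{..<k}. x t \<in> Xp t}"

definition anchor_mass :: "nat \<Rightarrow> real" where
  "anchor_mass t = (\<Sum>u\<in>Xp t. marg_single t u)"

lemma finite_Xp: "t < k \<Longrightarrow> finite (Xp t)"
  using Xp finite_X by (blast intro: finite_subset)

lemma anchors_subset: "anchors x \<subseteq> {..<k}"
  by (auto simp: anchors_def)

lemma mu_anchors:
  "x \<in> Q \<Longrightarrow> mu x = marg k X mu ({..<k} - anchors x) x * (\<Prod>t\<in>anchors x. marg_single t (x t))"
  using anchor_prod[of x] by (simp add: anchors_def marg_singleton)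

lemma anchor_mass_eq: "t < k \<Longrightarrow> anchor_mass t = (\<Sum>x | x \<in> Q \<and> x t \<in> Xp t. mu x)"
  unfolding anchor_mass_def by (intro sum_marg_single finite_Xp)

lemma anchor_mass_ge: "t < k \<Longrightarrow> \<alpha> \<le> anchor_mass t"
  using anchor_prob anchor_mass_eq by simp

lemma anchor_mass_compl:
  assumes "t < k"
  shows "(\<Sum>x | x \<in> Q \<and> x t \<notin> Xp t. mu x) = 1 - anchor_mass t"
proof -
  have "sum mu Q = (\<Sum>x | x \<in> Q \<and> x t \<in> Xp t. mu x) + (\<Sum>x | x \<in> Q \<and> x t \<notin> Xp t. mu x)"
    using finite_Q by (subst sum.union_disjoint[symmetric]) (auto intro: sum.cong)
  thus ?thesis using sum_mu anchor_mass_eq[OF assms] by simp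
qed

lemma anchor_mass_le_1: "t < k \<Longrightarrow> anchor_mass t \<le> 1"
  using anchor_mass_compl[of t] sum_nonneg[of "{x \<in> Q. x t \<notin> Xp t}" mu] mu_nonneg by auto

text \<open>The index set is a box, \<open>Xp t\<close> for \<open>t\<close> in \<open>U\<close> and
  the single point \<open>x t\<close> elsewhere, so the sum factorises.\<close>

lemma sum_prod_marg_single:
  assumes U: "U \<subseteq> {..<k}" and x: "x \<in> Q"
  shows "(\<Sum>x' | x' \<in> Q \<and> (\<forall>t\<in>U. x' t \<in> Xp t) \<and> (\<forall>t\<in>{..<k} - U. x' t = x t).
            \<Prod>t\<in>U. marg_single t (x' t)) = (\<Prod>t\<in>U. anchor_mass t)"
proof -
  let ?f = "\<lambda>t u. if t \<in> U then marg_single t u else 1"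
  let ?B = "\<lambda>t. if t \<in> U then Xp t else {x t}"
  have "{x'. x' \<in> Q \<and> (\<forall>t\<in>U. x' t \<in> Xp t) \<and> (\<forall>t\<in>{..<k} - U. x' t = x t)} = PiE {..<k} ?B"
  proof (intro equalityI subsetI)
    fix x' assume x': "x' \<in> PiE {..<k} ?B"
    have "x' t \<in> X t" if "t < k" for t
      using PiE_mem[OF x', of t] PiE_mem[OF x, of t] Xp[OF that] that by (auto split: if_splits)
    moreover have "x' t \<in> Xp t" if "t \<in> U" for t using PiE_mem[OF x', of t] that U by auto
    moreover have "x' t = x t" if "t \<in> {..<k} - U" for t using PiE_mem[OF x', of t] that by auto
    ultimately show "x' \<in> {x'. x' \<in> Q \<and> (\<forall>t\<in>U. x' t \<in> Xp t) \<and> (\<forall>t\<in>{..<k} - U. x' t = x t)}"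
      using x' by (auto simp: PiE_iff)
  qed (auto simp: PiE_iff)
  moreover have "(\<Prod>t\<in>U. marg_single t (x' t)) = (\<Prod>t<k. ?f t (x' t))" for x'
    using U by (intro prod.mono_neutral_cong_left) auto
  ultimately have "(\<Sum>x' | x' \<in> Q \<and> (\<forall>t\<in>U. x' t \<in> Xp t) \<and> (\<forall>t\<in>{..<k} - U. x' t = x t).
            \<Prod>t\<in>U. marg_single t (x' t)) = (\<Sum>x'\<in>PiE {..<k} ?B. \<Prod>t<k. ?f t (x' t))"
    by simp
  also have "\<dots> = (\<Prod>t<k. \<Sum>u\<in>?B t. ?f t u)"
    by (rule prod_sum_PiE[symmetric]) (auto simp: finite_Xp)
  also have "\<dots> = (\<Prod>t<k. if t \<in> U then anchor_mass t else 1)"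
    by (intro prod.cong) (auto simp: anchor_mass_def)
  also have "\<dots> = (\<Prod>t\<in>U. anchor_mass t)"
    using U by (intro prod.mono_neutral_cong_right) auto
  finally show ?thesis .
qed

text \<open>For \<open>x'\<close> with anchor set exactly \<open>U\<close>, the anchor condition
  expresses \<open>mu x'\<close> through a marginal, a sum over tuples \<open>x''\<close> that agree
  with \<open>x'\<close> off \<open>U\<close> and hence have their anchors inside \<open>U\<close>.
  After exchanging the sums, the one over \<open>x'\<close> factorises. The result is the recursion
  of \<open>subset_recursion_product\<close>.\<close>

lemma sum_anchors_recursion:
  assumes S: "S \<subseteq> {..<k}" and xS: "\<And>s. s \<in> S \<Longrightarrow> x s \<notin> Xp s" and U: "U \<subseteq> {..<k} - S"
  shows "(\<Sum>x' | x' \<in> Q \<and> (\<forall>s\<in>S. x' s = x s) \<and> anchors x' = U. mu x')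
       = (\<Prod>t\<in>U. anchor_mass t) * (\<Sum>x' | x' \<in> Q \<and> (\<forall>s\<in>S. x' s = x s) \<and> anchors x' \<subseteq> U. mu x')"
proof -
  let ?E = "{x'. x' \<in> Q \<and> (\<forall>s\<in>S. x' s = x s) \<and> anchors x' = U}"
  let ?E' = "{x'. x' \<in> Q \<and> (\<forall>s\<in>S. x' s = x s) \<and> anchors x' \<subseteq> U}"
  let ?g = "\<lambda>x'. \<Prod>t\<in>U. marg_single t (x' t)"
  have fin: "finite ?E" "finite ?E'" using finite_Q by auto
  have "sum mu ?E = (\<Sum>x'\<in>?E. \<Sum>x'' | x'' \<in> ?E' \<and> (\<forall>t\<in>{..<k} - U. x'' t = x' t). mu x'' * ?g x')"
  proof (intro sum.cong refl)
    fix x' assume x': "x' \<in> ?E"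
    have "{x''. x'' \<in> ?E' \<and> (\<forall>t\<in>{..<k} - U. x'' t = x' t)}
        = {x''. x'' \<in> Q \<and> (\<forall>t\<in>{..<k} - U. x'' t = x' t)}"
    proof (intro Collect_cong iffI conjI; elim conjE)
      fix x'' assume x'': "x'' \<in> Q" "\<forall>t\<in>{..<k} - U. x'' t = x' t"
      have "x'' s = x s" if "s \<in> S" for s
      proof -
        have "s \<in> {..<k} - U" using that S U by auto
        thus ?thesis using x'' x' that by auto
      qed
      moreover have "t \<in> U" if "t \<in> anchors x''" for t
      proof (rule ccontr)
        assume "t \<notin> U"
        hence "x'' t = x' t" using x'' that by (auto simp: anchors_def)
        hence "t \<in> anchors x'" using that by (auto simp: anchors_def)
        thus False using x' \<open>t \<notin> U\<close> by simp
      qed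
      ultimately show "x'' \<in> ?E'" using x'' by auto
    qed auto
    moreover have "mu x' = marg k X mu ({..<k} - U) x' * ?g x'"
      using mu_anchors[of x'] x' by simp
    ultimately show "mu x' = (\<Sum>x'' | x'' \<in> ?E' \<and> (\<forall>t\<in>{..<k} - U. x'' t = x' t). mu x'' * ?g x')"
      by (simp add: marg_def flip: sum_distrib_right)
  qed
  also have "\<dots> = (\<Sum>x''\<in>?E'. \<Sum>x' | x' \<in> ?E \<and> (\<forall>t\<in>{..<k} - U. x'' t = x' t). mu x'' * ?g x')"
    by (rule sum.swap_restrict[OF fin])
  also have "\<dots> = (\<Sum>x''\<in>?E'. mu x'' * (\<Prod>t\<in>U. anchor_mass t))"
  proof (intro sum.cong refl)
    fix x'' assume x'': "x'' \<in> ?E'"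
    have "{x'. x' \<in> ?E \<and> (\<forall>t\<in>{..<k} - U. x'' t = x' t)}
        = {x'. x' \<in> Q \<and> (\<forall>t\<in>U. x' t \<in> Xp t) \<and> (\<forall>t\<in>{..<k} - U. x' t = x'' t)}"
    proof (intro Collect_cong iffI conjI; elim conjE)
      fix x' assume x': "x' \<in> Q" "\<forall>t\<in>U. x' t \<in> Xp t" "\<forall>t\<in>{..<k} - U. x' t = x'' t"
      have "x' s = x s" if "s \<in> S" for s
      proof -
        have "s \<in> {..<k} - U" using that S U by auto
        thus ?thesis using x'' x' that by auto
      qed
      moreover have "t \<in> U" if "t \<in> anchors x'" for t
      proof (rule ccontr)
        assume "t \<notin> U"
        hence "x'' t = x' t" using x' that by (auto simp: anchors_def)
        hence "t \<in> anchors x''" using that by (auto simp: anchors_def)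
        thus False using x'' \<open>t \<notin> U\<close> by auto
      qed
      moreover have "U \<subseteq> anchors x'" using x' U by (auto simp: anchors_def)
      ultimately show "x' \<in> ?E" using x' by auto
    qed (auto simp: anchors_def)
    thus "(\<Sum>x' | x' \<in> ?E \<and> (\<forall>t\<in>{..<k} - U. x'' t = x' t). mu x'' * ?g x')
        = mu x'' * (\<Prod>t\<in>U. anchor_mass t)"
      using sum_prod_marg_single[of U x''] x'' order_trans[OF U Diff_subset]
      by (simp flip: sum_distrib_left)
  qed
  finally show ?thesis by (simp add: mult.commute flip: sum_distrib_right)
qed

text \<open>The anchor condition gives \<open>mu x\<close> as \<open>m * G\<close> times the
  marginal of \<open>x j\<close>, with \<open>m\<close> the marginal on the non-anchor coordinates
  and \<open>G\<close> the product over the other anchors. What remains is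
  \<open>marg_compl j x = m * G\<close>. The slice through \<open>x\<close> also contains tuples
  whose entry at \<open>j\<close> is no anchor; their mass comes from
  \<open>subset_recursion_remove\<close>.\<close>

lemma mu_anchor_split:
  assumes x: "x \<in> Q" and j: "j < k" and xj: "x j \<in> Xp j"
  shows "mu x = marg_single j (x j) * marg_compl j x"
proof -
  define F where "F = anchors x"
  define S where "S = {..<k} - F"
  define e where "e = (\<lambda>U. \<Sum>x' | x' \<in> Q \<and> (\<forall>s\<in>S. x' s = x s) \<and> anchors x' = U. mu x')"
  define G where "G = (\<Prod>t\<in>F - {j}. marg_single t (x t))"
  define m where "m = marg k X mu S x"
  have F: "F \<subseteq> {..<k}" "finite F" "j \<in> F"
    using j xj anchors_subset by (auto simp: F_def anchors_def)
  have S: "S \<subseteq> {..<k}" "\<And>s. s \<in> S \<Longrightarrow> x s \<notin> Xp s" "{..<k} - S = F"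
    using F(1) by (auto simp: S_def F_def anchors_def)
  have E: "(\<Sum>U'\<in>Pow U. e U') = (\<Sum>x' | x' \<in> Q \<and> (\<forall>s\<in>S. x' s = x s) \<and> anchors x' \<subseteq> U. mu x')"
    if U: "U \<subseteq> F" for U
  proof -
    have "(\<Sum>U'\<in>Pow U. e U') = (\<Sum>U'\<in>Pow U. \<Sum>x' | x' \<in> {x'\<in>Q. (\<forall>s\<in>S. x' s = x s) \<and> anchors x' \<subseteq> U} \<and> anchors x' = U'. mu x')"
      unfolding e_def by (intro sum.cong refl) auto
    also have "\<dots> = (\<Sum>x' | x' \<in> Q \<and> (\<forall>s\<in>S. x' s = x s) \<and> anchors x' \<subseteq> U. mu x')"
      using finite_Q finite_subset[OF U F(2)] by (intro sum.group) auto
    finally show ?thesis .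
  qed
  \<comment> \<open>Even when the non-anchor questions of \<open>x\<close> are fixed, the question
    of \<open>j\<close> is an anchor with probability \<open>anchor_mass j\<close>.\<close>
  have "(\<Sum>U\<in>Pow (F - {j}). e U) = (1 - anchor_mass j) * (\<Sum>U\<in>Pow F. e U)"
  proof (rule subset_recursion_remove)
    fix t assume "t \<in> F"
    thus "0 \<le> anchor_mass t \<and> anchor_mass t \<le> 1"
      using F alpha anchor_mass_ge[of t] anchor_mass_le_1[of t] by auto
  next
    fix U assume U: "U \<subseteq> F"
    show "e U = (\<Prod>t\<in>U. anchor_mass t) * (\<Sum>U'\<in>Pow U. e U')"
      unfolding E[OF U] unfolding e_def using S U by (intro sum_anchors_recursion) auto
  next
    fix t U assume t: "t \<in> F" "anchor_mass t = 1" "U \<subseteq> F" "t \<notin> U"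
    have "e U \<le> (\<Sum>x' | x' \<in> Q \<and> x' t \<notin> Xp t. mu x')"
      unfolding e_def using finite_Q t F by (intro sum_mono2) (auto simp: mu_nonneg anchors_def)
    also have "\<dots> = 0" using anchor_mass_compl[of t] t F by auto
    finally show "e U = 0" using mu_nonneg by (simp add: e_def sum_nonneg antisym)
  qed (use F in auto)
  moreover have "(\<Sum>U\<in>Pow F. e U) = m"
    unfolding E[OF order_refl] m_def marg_def using S by (intro sum.cong) (auto simp: anchors_def)
  moreover have "(\<Sum>U\<in>Pow (F - {j}). e U) = (\<Sum>x' | x' \<in> Q \<and> (\<forall>s\<in>S. x' s = x s) \<and> x' j \<notin> Xp j. mu x')"
    unfolding E[OF Diff_subset] using S F by (intro sum.cong) (auto simp: anchors_def)
  ultimately have nonanchor: "(\<Sum>x' | x' \<in> Q \<and> (\<forall>s\<in>S. x' s = x s) \<and> x' j \<notin> Xp j. mu x') = (1 - anchor_mass j) * m"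
    by simp
  have in_anchor: "mu (x(j := u)) = m * G * marg_single j u" if u: "u \<in> Xp j" for u
  proof -
    have "x(j := u) \<in> Q" using x j u Xp[OF j] by (auto simp: PiE_iff extensional_def)
    moreover have "anchors (x(j := u)) = F" using u xj j by (auto simp: F_def anchors_def)
    moreover have "marg k X mu S (x(j := u)) = m"
      unfolding m_def marg_def using F S by (intro sum.cong) auto
    moreover have "(\<Prod>t\<in>F. marg_single t ((x(j := u)) t)) = marg_single j u * G"
      unfolding G_def prod.remove[OF F(2,3)] by (auto intro!: prod.cong)
    ultimately show ?thesis using mu_anchors[of "x(j := u)"] by (simp add: S_def)
  qed
  \<comment> \<open>A non-anchor at \<open>j\<close> shrinks the anchor set to
    \<open>F - {j}\<close>: the marginal now includes \<open>j\<close>, while the factor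
    \<open>G\<close> is unchanged.\<close>
  have out_anchor: "mu (x(j := u)) = marg k X mu (insert j S) (x(j := u)) * G" if u: "u \<in> X j - Xp j" for u
  proof -
    have "x(j := u) \<in> Q" using x j u by (auto simp: PiE_iff extensional_def)
    moreover have "anchors (x(j := u)) = F - {j}" using u j by (auto simp: F_def anchors_def)
    moreover have "{..<k} - (F - {j}) = insert j S" using j by (auto simp: S_def)
    moreover have "(\<Prod>t\<in>F - {j}. marg_single t ((x(j := u)) t)) = G"
      unfolding G_def by (intro prod.cong) auto
    ultimately show ?thesis using mu_anchors[of "x(j := u)"] by simp
  qed
  have "slice j x = (\<lambda>u. x(j := u)) ` X j"
  proof (intro equalityI subsetI)
    fix y assume y: "y \<in> slice j x"
    have "y = x(j := y j)"
    proof
      fix t show "y t = (x(j := y j)) t"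
        using y x by (cases "t < k") (auto simp: slice_def PiE_iff extensional_def)
    qed
    moreover have "y j \<in> X j" using y j by (auto simp: slice_def PiE_iff)
    ultimately show "y \<in> (\<lambda>u. x(j := u)) ` X j" by blast
  qed (use x j in \<open>auto simp: slice_def PiE_iff extensional_def split: if_splits\<close>)
  moreover have "inj_on (\<lambda>u. x(j := u)) (X j)" by (auto simp: inj_on_def dest: fun_upd_eqD)
  ultimately have "marg_compl j x = (\<Sum>u\<in>X j. mu (x(j := u)))"
    unfolding marg_compl_eq by (simp add: sum.reindex)
  also have "\<dots> = (\<Sum>u\<in>X j - Xp j. mu (x(j := u))) + (\<Sum>u\<in>Xp j. mu (x(j := u)))"
    using Xp[OF j] finite_X[OF j] by (rule sum.subset_diff)
  also have "(\<Sum>u\<in>Xp j. mu (x(j := u))) = m * G * anchor_mass j"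
    unfolding anchor_mass_def sum_distrib_left using in_anchor by (intro sum.cong) auto
  also have "(\<Sum>u\<in>X j - Xp j. mu (x(j := u))) = (\<Sum>u\<in>X j - Xp j. marg k X mu (insert j S) (x(j := u))) * G"
    unfolding sum_distrib_right using out_anchor by (intro sum.cong) auto
  also have "(\<Sum>u\<in>X j - Xp j. marg k X mu (insert j S) (x(j := u)))
     = (\<Sum>u\<in>X j - Xp j. \<Sum>x' | x' \<in> {x'\<in>Q. (\<forall>s\<in>S. x' s = x s) \<and> x' j \<notin> Xp j} \<and> x' j = u. mu x')"
    unfolding marg_def using F by (intro sum.cong refl) (auto simp: S_def)
  also have "\<dots> = (\<Sum>x' | x' \<in> Q \<and> (\<forall>s\<in>S. x' s = x s) \<and> x' j \<notin> Xp j. mu x')"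
    using finite_Q finite_X[OF j] j by (intro sum.group) auto
  finally have "marg_compl j x = m * G" unfolding nonanchor by (simp add: algebra_simps)
  moreover have "mu x = m * G * marg_single j (x j)" using in_anchor[OF xj] by simp
  ultimately show ?thesis by simp
qed

text \<open>By \<open>mu_anchor_split\<close>, the probability with which the Gibbs step draws an
  anchor value does not depend on the other coordinates. On a slice of mass 0 both sides vanish by
  \<open>supported\<close>.\<close>

lemma resample_anchor:
  assumes "supported \<phi>" and x: "x \<in> Q" and j: "j < k" and xj: "x j \<in> Xp j"
  shows "resample j \<phi> x = marg_single j (x j) * sum \<phi> (slice j x)"
proof (cases "marg_compl j x = 0")
  case True
  have "\<phi> y = 0" if y: "y \<in> slice j x" for y
  proof -
    have "mu y \<le> marg_compl j y" using y slice_subset by (intro mu_le_marg_compl) auto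
    also have "\<dots> = 0" using True slice_eq[OF y] by (simp add: marg_compl_eq)
    finally show ?thesis using mu_nonneg[of y] assms(1) y slice_subset by (force simp: supported_def)
  qed
  thus ?thesis by (simp add: resample_def)
next
  case False
  thus ?thesis using mu_anchor_split[OF x j xj] by (simp add: resample_def)
qed

text \<open>Induction over the steps: each one hits its anchor value with probability
  \<open>marg_single\<close>, whatever the current state. The starting point is constrained only in
  the coordinates not yet updated, so for \<open>j = k\<close> the sum is the whole mass of
  \<open>\<phi>\<close>.\<close>

lemma sweep_minorization:
  assumes phi: "supported \<phi>" "\<And>x. x \<in> Q \<Longrightarrow> 0 \<le> \<phi> x"
    and "j \<le> k" "y \<in> Q" "\<And>t. t < j \<Longrightarrow> y t \<in> Xp t"
  shows "(\<Prod>t<j. marg_single t (y t)) * (\<Sum>x | x \<in> Q \<and> (\<forall>t\<in>{j..<k}. x t = y t). \<phi> x) \<le> sweep j \<phi> y"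
  using assms(3-)
proof (induction j arbitrary: y)
  case 0
  have "{x. x \<in> Q \<and> (\<forall>t\<in>{0..<k}. x t = y t)} = {y}"
    using 0 by (auto intro: PiE_ext)
  thus ?case by simp
next
  case (Suc j)
  have j: "j < k" using Suc.prems by simp
  let ?W = "\<lambda>y. {x. x \<in> Q \<and> (\<forall>t\<in>{j..<k}. x t = y t)}"
  let ?W' = "{x. x \<in> Q \<and> (\<forall>t\<in>{Suc j..<k}. x t = y t)}"
  \<comment> \<open>Letting \<open>y'\<close> run through the slice releases the constraint on
    coordinate \<open>j\<close> of the starting point.\<close>
  have "(\<Sum>y'\<in>slice j y. \<Sum>x\<in>?W y'. \<phi> x) = (\<Sum>y'\<in>slice j y. \<Sum>x | x \<in> ?W' \<and> y(j := x j) = y'. \<phi> x)"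
  proof (intro sum.cong refl)
    fix y' assume y': "y' \<in> slice j y"
    have "y(j := x j) = y' \<longleftrightarrow> x j = y' j" for x
    proof
      assume *: "x j = y' j"
      show "y(j := x j) = y'"
      proof
        fix t show "(y(j := x j)) t = y' t"
          using * y' Suc.prems(2) by (cases "t < k") (auto simp: slice_def PiE_iff extensional_def)
      qed
    qed auto
    moreover have "(\<forall>t\<in>{j..<k}. x t = y' t) \<longleftrightarrow> x j = y' j \<and> (\<forall>t\<in>{Suc j..<k}. x t = y t)" for x
    proof -
      have "{j..<k} = insert j {Suc j..<k}" using j by auto
      thus ?thesis using y' by (auto simp: slice_def)
    qed
    ultimately show "?W y' = {x. x \<in> ?W' \<and> y(j := x j) = y'}" by auto
  qed
  also have "\<dots> = (\<Sum>x\<in>?W'. \<phi> x)"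
  proof (rule sum.group)
    show "(\<lambda>x. y(j := x j)) ` ?W' \<subseteq> slice j y"
      using Suc.prems j by (auto simp: slice_def PiE_iff extensional_def split: if_splits)
  qed (use finite_Q finite_slice in auto)
  finally have W: "(\<Sum>y'\<in>slice j y. \<Sum>x\<in>?W y'. \<phi> x) = (\<Sum>x\<in>?W'. \<phi> x)" .
  have "(\<Prod>t<Suc j. marg_single t (y t)) * (\<Sum>x\<in>?W'. \<phi> x)
      = marg_single j (y j) * (\<Sum>y'\<in>slice j y. (\<Prod>t<j. marg_single t (y t)) * (\<Sum>x\<in>?W y'. \<phi> x))"
    unfolding W[symmetric] by (simp add: mult_ac flip: sum_distrib_left)
  also have "\<dots> \<le> marg_single j (y j) * (\<Sum>y'\<in>slice j y. sweep j \<phi> y')"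
  proof (intro mult_left_mono sum_mono marg_single_nonneg)
    fix y' assume y': "y' \<in> slice j y"
    have eq: "y' t = y t" if "t < j" for t using y' that j by (auto simp: slice_def)
    hence "(\<Prod>t<j. marg_single t (y t)) = (\<Prod>t<j. marg_single t (y' t))" by simp
    thus "(\<Prod>t<j. marg_single t (y t)) * (\<Sum>x\<in>?W y'. \<phi> x) \<le> sweep j \<phi> y'"
      using Suc.IH[of y'] Suc.prems subsetD[OF slice_subset y'] eq by auto
  qed
  also have "\<dots> = sweep (Suc j) \<phi> y"
    using resample_anchor[of "sweep j \<phi>" y j] supported_sweep[OF phi(1)] Suc.prems j by simp
  finally show ?case .
qed

text \<open>Doeblin's condition for a full sweep: whatever the starting point, with probability at least
  \<open>\<alpha>\<^sup>k\<close> all coordinates are anchors afterwards, with a law independent of that point.\<close>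

lemma L1_sweep_contract:
  assumes supp: "supported d" and sum0: "sum d Q = 0"
  shows "L1 (sweep k d) \<le> (1 - \<alpha> ^ k) * L1 d"
proof -
  define dp where "dp = (\<lambda>x. max (d x) 0)"
  define dm where "dm = (\<lambda>x. max (- d x) 0)"
  define w where "w = (\<lambda>y. if y \<in> PiE {..<k} Xp then \<Prod>t<k. marg_single t (y t) else 0)"
  define s where "s = sum dp Q"
  have d: "d = (\<lambda>x. dp x - dm x)" by (auto simp: dp_def dm_def fun_eq_iff)
  have sdm: "sum dm Q = s" using sum0 unfolding d sum_subtractf s_def by simp
  have "L1 d = (\<Sum>x\<in>Q. dp x + dm x)" unfolding L1_def by (intro sum.cong) (auto simp: dp_def dm_def)
  hence L1d: "L1 d = 2 * s" using sdm by (simp add: sum.distrib s_def)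
  have supp': "supported dp" "supported dm" using supp by (auto simp: supported_def dp_def dm_def)
  have nn: "0 \<le> dp x" "0 \<le> dm x" for x by (auto simp: dp_def dm_def)
  have s0: "0 \<le> s" by (simp add: s_def sum_nonneg nn)
  have minor: "s * w y \<le> sweep k \<phi> y"
    if phi: "supported \<phi>" "\<And>x. 0 \<le> \<phi> x" "sum \<phi> Q = s" and y: "y \<in> Q" for \<phi> y
  proof (cases "y \<in> PiE {..<k} Xp")
    case True
    thus ?thesis using sweep_minorization[of \<phi> k y] phi y
      by (simp add: w_def PiE_mem mult.commute[of s])
  next
    case False
    thus ?thesis using sweep_nonneg[of \<phi> y k] phi y by (simp add: w_def)
  qed
  have "(\<Sum>y\<in>Q. w y) = (\<Sum>y\<in>PiE {..<k} Xp. \<Prod>t<k. marg_single t (y t))"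
    unfolding w_def using finite_Q Xp PiE_mono[of "{..<k}" Xp X]
    by (intro sum.mono_neutral_cong_right) auto
  also have "\<dots> = (\<Prod>t<k. anchor_mass t)"
    unfolding anchor_mass_def by (rule prod_sum_PiE[symmetric]) (auto simp: finite_Xp)
  also have "\<dots> \<ge> (\<Prod>t<k. \<alpha>)"
    using alpha anchor_mass_ge by (intro prod_mono) auto
  finally have w: "\<alpha> ^ k \<le> (\<Sum>y\<in>Q. w y)" by simp
  \<comment> \<open>The positive and the negative part of \<open>d\<close> have the same mass
    \<open>s\<close>; after the sweep both dominate \<open>s * w\<close>, which cancels in their
    difference.\<close>
  have "L1 (sweep k d) \<le> (\<Sum>y\<in>Q. (sweep k dp y - s * w y) + (sweep k dm y - s * w y))"
    unfolding L1_def
  proof (rule sum_mono)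
    fix y assume y: "y \<in> Q"
    have "sweep k d y = sweep k dp y - sweep k dm y" unfolding d sweep_diff by simp
    thus "\<bar>sweep k d y\<bar> \<le> (sweep k dp y - s * w y) + (sweep k dm y - s * w y)"
      using minor[OF supp'(1) nn(1) s_def[symmetric] y] minor[OF supp'(2) nn(2) sdm y] by simp
  qed
  also have "\<dots> = 2 * s - 2 * s * (\<Sum>y\<in>Q. w y)"
    using sum_sweep[OF supp'(1), of k, folded s_def] sum_sweep[OF supp'(2), of k, unfolded sdm]
    by (simp add: sum.distrib sum_subtractf flip: sum_distrib_left)
  also have "\<dots> \<le> 2 * s - 2 * s * \<alpha> ^ k"
    using w s0 by (simp add: mult_left_mono)
  finally show ?thesis by (simp add: L1d algebra_simps)
qed

text \<open>The distance to the product is split at the swept law. The second part is the sweep of a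
  function of mass 0 and is contracted by \<open>1 - \<alpha> ^ k\<close>; moved to the left it
  leaves the factor \<open>\<alpha> ^ k\<close>, and the first part telescopes into single
  steps.\<close>

lemma L1_to_product_le:
  assumes supp: "supported \<phi>"
  shows "\<alpha> ^ k * L1 (\<lambda>x. \<phi> x - mu x * sum \<phi> Q) \<le> (\<Sum>t<k. L1 (\<lambda>x. \<phi> x - resample t \<phi> x))"
proof -
  define d where "d = (\<lambda>x. \<phi> x - mu x * sum \<phi> Q)"
  have "L1 (\<lambda>x. \<phi> x - mu x * sum \<phi> Q)
      \<le> L1 (\<lambda>x. \<phi> x - sweep k \<phi> x) + L1 (\<lambda>x. sweep k \<phi> x - mu x * sum \<phi> Q)"
    by (rule L1_triangle)
  also have "L1 (\<lambda>x. sweep k \<phi> x - mu x * sum \<phi> Q) = L1 (sweep k d)"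
    unfolding L1_def d_def sweep_diff by (intro sum.cong) (auto simp: sweep_mu)
  also have "\<dots> \<le> (1 - \<alpha> ^ k) * L1 d"
  proof (rule L1_sweep_contract)
    show "supported d" using supp by (auto simp: d_def supported_def)
    show "sum d Q = 0" using sum_mu by (simp add: d_def sum_subtractf flip: sum_distrib_right)
  qed
  finally show ?thesis using L1_diff_sweep_le[OF supp, of k] by (simp add: d_def algebra_simps)
qed

end

section \<open>Mixed strategies and conditioning on won rounds\<close>

context finite_game
begin

lemma win_prob_nonneg: "0 \<le> win_prob k X mu V f"
  unfolding win_prob_def by (intro sum_nonneg) (simp add: mu_nonneg)

lemma win_prob_le_val:
  assumes "f \<in> strategies k X A"
  shows "win_prob k X mu V f \<le> val k X A mu V"
proof -
  have "finite (strategies k X A)"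
    unfolding strategies_def by (intro finite_PiE) (auto simp: finite_X finite_A)
  thus ?thesis unfolding val_def using assms by (intro cSUP_upper bdd_above_finite) auto
qed

lemma val_nonneg: "0 \<le> val k X A mu V"
proof -
  have "strategies k X A \<noteq> {}"
    using A_nonempty by (auto simp: strategies_def PiE_eq_empty_iff)
  then obtain f where "f \<in> strategies k X A" by blast
  thus ?thesis using win_prob_nonneg win_prob_le_val order_trans by blast
qed

text \<open>Private randomness does not help: on question \<open>u\<close>, player \<open>t\<close>
  draws \<open>c\<close> from \<open>\<pi> t u\<close> and answers \<open>g t c\<close>. Drawing a
  table \<open>F\<close> of all choices in advance makes this an average of the deterministic
  strategies \<open>strat F\<close>.\<close>

lemma mixed_strategy_le_val:
  fixes S :: "nat \<Rightarrow> 'c set" and g :: "nat \<Rightarrow> 'c \<Rightarrow> 'a" and \<pi> :: "nat \<Rightarrow> 'q \<Rightarrow> 'c \<Rightarrow> real"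
  assumes S: "\<And>t. t < k \<Longrightarrow> finite (S t)"
    and g: "\<And>t c. t < k \<Longrightarrow> c \<in> S t \<Longrightarrow> g t c \<in> A t"
    and pi_nonneg: "\<And>t u c. 0 \<le> \<pi> t u c"
    and pi_sum: "\<And>t u. t < k \<Longrightarrow> u \<in> X t \<Longrightarrow> (\<Sum>c\<in>S t. \<pi> t u c) = 1"
  shows "(\<Sum>x\<in>Q. mu x * (\<Sum>c\<in>PiE {..<k} S. (\<Prod>t<k. \<pi> t (x t) (c t)) * of_bool (V x (\<lambda>t\<in>{..<k}. g t (c t)))))
       \<le> val k X A mu V"
proof -
  define H where "H = PiE {..<k} (\<lambda>t. X t \<rightarrow>\<^sub>E S t)"
  define wt where "wt = (\<lambda>F. \<Prod>t<k. \<Prod>u\<in>X t. \<pi> t u (F t u))"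
  define strat where "strat = (\<lambda>F. \<lambda>t\<in>{..<k}. \<lambda>u\<in>X t. g t (F t u))"
  have fin: "finite (X t \<rightarrow>\<^sub>E S t)" if "t < k" for t
    using S finite_X that by (intro finite_PiE) auto
  have finH: "finite H" unfolding H_def by (intro finite_PiE) (auto simp: S finite_X)
  have sum_wt: "(\<Sum>F\<in>H. wt F) = 1"
  proof -
    have "(\<Sum>F\<in>H. wt F) = (\<Prod>t<k. \<Sum>\<phi>\<in>X t \<rightarrow>\<^sub>E S t. \<Prod>u\<in>X t. \<pi> t u (\<phi> u))"
      unfolding H_def wt_def using fin by (intro prod_sum_PiE[symmetric]) simp_all
    also have "\<dots> = (\<Prod>t<k. \<Prod>u\<in>X t. \<Sum>c\<in>S t. \<pi> t u c)"
      using finite_X S by (intro prod.cong refl prod_sum_PiE[symmetric]) auto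
    also have "\<dots> = 1" using pi_sum by (intro prod.neutral ballI) auto
    finally show ?thesis .
  qed
  \<comment> \<open>Only the table entries queried by \<open>x\<close> matter; all others sum to
    1.\<close>
  have sum_ev: "(\<Sum>F | F \<in> H \<and> (\<lambda>t\<in>{..<k}. F t (x t)) = c. wt F) = (\<Prod>t<k. \<pi> t (x t) (c t))"
    if x: "x \<in> Q" and c: "c \<in> PiE {..<k} S" for x c
  proof -
    let ?B = "\<lambda>t u. if u = x t then {c t} else S t"
    have xX: "x t \<in> X t" "c t \<in> S t" if "t < k" for t using x c that by auto
    have "{F. F \<in> H \<and> (\<lambda>t\<in>{..<k}. F t (x t)) = c} = PiE {..<k} (\<lambda>t. PiE (X t) (?B t))"
    proof (intro equalityI subsetI)
      fix F assume F: "F \<in> PiE {..<k} (\<lambda>t. PiE (X t) (?B t))"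
      have Ft: "F t \<in> X t \<rightarrow>\<^sub>E S t" "F t (x t) = c t" if t: "t < k" for t
      proof -
        have *: "F t \<in> PiE (X t) (?B t)" using F t by auto
        show "F t (x t) = c t" using PiE_mem[OF * xX(1)[OF t]] by simp
        show "F t \<in> X t \<rightarrow>\<^sub>E S t"
        proof (rule PiE_I)
          fix u assume u: "u \<in> X t"
          show "F t u \<in> S t" using PiE_mem[OF * u] xX(2)[OF t] by (cases "u = x t") auto
        next
          fix u assume "u \<notin> X t"
          thus "F t u = undefined" by (rule PiE_arb[OF *])
        qed
      qed
      have "F \<in> H" using F Ft by (auto simp: H_def PiE_iff)
      moreover have "(\<lambda>t\<in>{..<k}. F t (x t)) = c"
        using Ft c by (auto simp: fun_eq_iff PiE_iff extensional_def)
      ultimately show "F \<in> {F. F \<in> H \<and> (\<lambda>t\<in>{..<k}. F t (x t)) = c}" by simp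
    next
      fix F assume "F \<in> {F. F \<in> H \<and> (\<lambda>t\<in>{..<k}. F t (x t)) = c}"
      thus "F \<in> PiE {..<k} (\<lambda>t. PiE (X t) (?B t))"
        by (auto simp: H_def PiE_iff)
    qed
    hence "(\<Sum>F | F \<in> H \<and> (\<lambda>t\<in>{..<k}. F t (x t)) = c. wt F)
        = (\<Prod>t<k. \<Sum>\<phi>\<in>PiE (X t) (?B t). \<Prod>u\<in>X t. \<pi> t u (\<phi> u))"
      unfolding wt_def using S finite_X
      by (simp only:, intro prod_sum_PiE[symmetric] finite_PiE) auto
    also have "\<dots> = (\<Prod>t<k. \<Prod>u\<in>X t. \<Sum>c'\<in>?B t u. \<pi> t u c')"
      using finite_X S by (intro prod.cong refl prod_sum_PiE[symmetric]) auto
    also have "\<dots> = (\<Prod>t<k. \<Prod>u\<in>X t. if u = x t then \<pi> t u (c t) else 1)"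
      using pi_sum by (intro prod.cong refl) auto
    also have "\<dots> = (\<Prod>t<k. \<pi> t (x t) (c t))"
      using finite_X xX by (intro prod.cong refl) (auto simp: prod.delta)
    finally show ?thesis .
  qed
  have "(\<Sum>x\<in>Q. mu x * (\<Sum>c\<in>PiE {..<k} S. (\<Prod>t<k. \<pi> t (x t) (c t)) * of_bool (V x (\<lambda>t\<in>{..<k}. g t (c t)))))
      = (\<Sum>x\<in>Q. mu x * (\<Sum>F\<in>H. wt F * of_bool (V x (\<lambda>t\<in>{..<k}. strat F t (x t)))))"
  proof (intro sum.cong refl arg_cong2[where f = "(*)"])
    fix x assume x: "x \<in> Q"
    have "(\<Sum>c\<in>PiE {..<k} S. (\<Prod>t<k. \<pi> t (x t) (c t)) * of_bool (V x (\<lambda>t\<in>{..<k}. g t (c t))))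
        = (\<Sum>c\<in>PiE {..<k} S. \<Sum>F | F \<in> H \<and> (\<lambda>t\<in>{..<k}. F t (x t)) = c.
             wt F * of_bool (V x (\<lambda>t\<in>{..<k}. strat F t (x t))))"
    proof (intro sum.cong refl)
      fix c assume c: "c \<in> PiE {..<k} S"
      have "(\<lambda>t\<in>{..<k}. strat F t (x t)) = (\<lambda>t\<in>{..<k}. g t (c t))"
        if "(\<lambda>t\<in>{..<k}. F t (x t)) = c" for F
        using x unfolding that[symmetric] by (auto simp: strat_def fun_eq_iff)
      thus "(\<Prod>t<k. \<pi> t (x t) (c t)) * of_bool (V x (\<lambda>t\<in>{..<k}. g t (c t)))
          = (\<Sum>F | F \<in> H \<and> (\<lambda>t\<in>{..<k}. F t (x t)) = c.
              wt F * of_bool (V x (\<lambda>t\<in>{..<k}. strat F t (x t))))"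
        unfolding sum_ev[OF x c, symmetric] sum_distrib_right by (intro sum.cong refl) auto
    qed
    also have "\<dots> = (\<Sum>F\<in>H. wt F * of_bool (V x (\<lambda>t\<in>{..<k}. strat F t (x t))))"
    proof (rule sum.group)
      show "(\<lambda>F. \<lambda>t\<in>{..<k}. F t (x t)) ` H \<subseteq> PiE {..<k} S"
        using x by (auto simp: H_def PiE_iff)
      show "finite (PiE {..<k} S)" using S by (intro finite_PiE) auto
    qed (rule finH)
    finally show "(\<Sum>c\<in>PiE {..<k} S. (\<Prod>t<k. \<pi> t (x t) (c t)) * of_bool (V x (\<lambda>t\<in>{..<k}. g t (c t))))
        = (\<Sum>F\<in>H. wt F * of_bool (V x (\<lambda>t\<in>{..<k}. strat F t (x t))))" .
  qed
  also have "\<dots> = (\<Sum>F\<in>H. wt F * win_prob k X mu V (strat F))"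
    unfolding win_prob_def sum_distrib_left
    by (subst sum.swap) (intro sum.cong refl, auto)
  also have "\<dots> \<le> (\<Sum>F\<in>H. wt F * val k X A mu V)"
  proof (intro sum_mono mult_left_mono win_prob_le_val)
    fix F assume F: "F \<in> H"
    show "strat F \<in> strategies k X A"
      using F g by (auto simp: strat_def strategies_def H_def PiE_iff)
    show "0 \<le> wt F" unfolding wt_def by (intro prod_nonneg ballI pi_nonneg)
  qed
  also have "\<dots> = val k X A mu V" by (simp add: sum_wt flip: sum_distrib_right)
  finally show ?thesis .
qed

end

section \<open>The repeated game under a fixed strategy\<close>

locale repeated_game = anchored_game k X A mu \<alpha> Xp
  for k :: nat and X :: "nat \<Rightarrow> 'q set" and A :: "nat \<Rightarrow> 'a set" and mu :: "(nat \<Rightarrow> 'q) \<Rightarrow> real"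
    and \<alpha> :: real and Xp :: "nat \<Rightarrow> 'q set" +
  fixes V :: "(nat \<Rightarrow> 'q) \<Rightarrow> (nat \<Rightarrow> 'a) \<Rightarrow> bool" and n :: nat and f :: "nat \<Rightarrow> (nat \<Rightarrow> 'q) \<Rightarrow> nat \<Rightarrow> 'a"
  assumes k_pos: "0 < k" and f: "f \<in> strategies k (rep_Q n X) (rep_A n A)"
begin

abbreviation Y where "Y \<equiv> PiE {..<k} (rep_Q n X)"

definition row :: "(nat \<Rightarrow> nat \<Rightarrow> 'q) \<Rightarrow> nat \<Rightarrow> nat \<Rightarrow> 'q" where
  "row y i = (\<lambda>t\<in>{..<k}. y t i)"

definition P :: "(nat \<Rightarrow> nat \<Rightarrow> 'q) \<Rightarrow> real" where
  "P y = (\<Prod>i<n. mu (row y i))"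

definition win :: "nat \<Rightarrow> (nat \<Rightarrow> nat \<Rightarrow> 'q) \<Rightarrow> bool" where
  "win i y \<longleftrightarrow> V (row y i) (\<lambda>t\<in>{..<k}. f t (y t) i)"

definition win_on :: "nat set \<Rightarrow> real" where
  "win_on C = (\<Sum>y | y \<in> Y \<and> (\<forall>i\<in>C. win i y). P y)"

lemma finite_Y: "finite Y"
  unfolding rep_Q_def using finite_X by (intro finite_PiE) auto

lemma P_nonneg: "0 \<le> P y"
  unfolding P_def by (intro prod_nonneg ballI mu_nonneg)

lemma row_in_Q: "y \<in> Y \<Longrightarrow> i < n \<Longrightarrow> row y i \<in> Q"
  by (auto simp: row_def rep_Q_def PiE_iff)

lemma answer_in_A: "y \<in> Y \<Longrightarrow> t < k \<Longrightarrow> i < n \<Longrightarrow> f t (y t) i \<in> A t"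
  using f by (auto simp: strategies_def rep_A_def PiE_iff)

lemma Y_eqI:
  assumes "y \<in> Y" "y' \<in> Y" "\<And>i t. i < n \<Longrightarrow> t < k \<Longrightarrow> y t i = y' t i"
  shows "y = y'"
proof (rule PiE_ext[OF assms(1,2)])
  fix t assume t: "t \<in> {..<k}"
  have "y t \<in> PiE {..<n} (\<lambda>_. X t)" "y' t \<in> PiE {..<n} (\<lambda>_. X t)"
    using assms(1,2) t by (auto simp: rep_Q_def PiE_iff)
  thus "y t = y' t" by (rule PiE_ext) (use assms(3) t in auto)
qed

lemma win_prob_rep: "win_prob k (rep_Q n X) (rep_mu n k X mu) (rep_V n k V) f = win_on {..<n}"
proof -
  have "win_prob k (rep_Q n X) (rep_mu n k X mu) (rep_V n k V) f
      = (\<Sum>y\<in>Y. if \<forall>i\<in>{..<n}. win i y then P y else 0)"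
    unfolding win_prob_def
  proof (intro sum.cong refl)
    fix y assume "y \<in> Y"
    moreover have "rep_V n k V y (\<lambda>t\<in>{..<k}. f t (y t)) \<longleftrightarrow> (\<forall>i\<in>{..<n}. win i y)"
    proof -
      have "(\<lambda>t\<in>{..<k}. (\<lambda>t\<in>{..<k}. f t (y t)) t i) = (\<lambda>t\<in>{..<k}. f t (y t) i)" for i
        by (auto simp: fun_eq_iff)
      thus ?thesis by (auto simp: rep_V_def win_def row_def)
    qed
    ultimately show "rep_mu n k X mu y * (if rep_V n k V y (\<lambda>t\<in>{..<k}. f t (y t)) then 1 else 0)
        = (if \<forall>i\<in>{..<n}. win i y then P y else 0)"
      by (simp add: rep_mu_def P_def row_def)
  qed
  also have "\<dots> = win_on {..<n}"
    unfolding win_on_def using finite_Y by (simp add: sum.inter_filter)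
  finally show ?thesis .
qed

lemma win_on_mono: "C \<subseteq> C' \<Longrightarrow> win_on C' \<le> win_on C"
  unfolding win_on_def using finite_Y by (intro sum_mono2) (auto simp: P_nonneg)

text \<open>Transposing a question tuple into its rows embeds \<open>Y\<close> in the
  \<open>n\<close>-fold power of \<open>Q\<close>, where the product law has mass 1.\<close>

lemma win_on_empty_le_1: "win_on {} \<le> 1"
proof -
  let ?r = "\<lambda>y. \<lambda>i\<in>{..<n}. row y i"
  have inj: "inj_on ?r Y"
  proof (rule inj_onI)
    fix y y' assume y: "y \<in> Y" "y' \<in> Y" "?r y = ?r y'"
    show "y = y'"
    proof (rule Y_eqI[OF y(1,2)])
      fix i t assume "i < n" "t < k"
      thus "y t i = y' t i" using fun_cong[OF fun_cong[OF y(3), of i], of t] by (simp add: row_def)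
    qed
  qed
  have "win_on {} = (\<Sum>x\<in>?r ` Y. \<Prod>i<n. mu (x i))"
    unfolding win_on_def P_def sum.reindex[OF inj] by simp
  also have "\<dots> \<le> (\<Sum>x\<in>PiE {..<n} (\<lambda>_. Q). \<Prod>i<n. mu (x i))"
    using row_in_Q finite_X
    by (intro sum_mono2 finite_PiE prod_nonneg ballI mu_nonneg) (simp_all add: image_subset_iff)
  also have "\<dots> = (\<Prod>i<n. \<Sum>x\<in>Q. mu x)"
    using finite_Q by (intro prod_sum_PiE[symmetric]) auto
  finally show ?thesis by (simp add: sum_mu)
qed

end

section \<open>The law conditioned on won rounds and its relative entropy\<close>

locale conditioned_game = repeated_game k X A mu \<alpha> Xp V n f
  for k :: nat and X :: "nat \<Rightarrow> 'q set" and A :: "nat \<Rightarrow> 'a set" and mu :: "(nat \<Rightarrow> 'q) \<Rightarrow> real"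
    and \<alpha> :: real and Xp :: "nat \<Rightarrow> 'q set" and V :: "(nat \<Rightarrow> 'q) \<Rightarrow> (nat \<Rightarrow> 'a) \<Rightarrow> bool" and n :: nat
    and f :: "nat \<Rightarrow> (nat \<Rightarrow> 'q) \<Rightarrow> nat \<Rightarrow> 'a" +
  fixes C :: "nat set"
  assumes C: "C \<subseteq> {..<n}" and win_C: "0 < win_on C"
begin

definition q :: "(nat \<Rightarrow> nat \<Rightarrow> 'q) \<Rightarrow> real" where
  "q y = (if \<forall>i\<in>C. win i y then P y / win_on C else 0)"

definition prq :: "((nat \<Rightarrow> nat \<Rightarrow> 'q) \<Rightarrow> bool) \<Rightarrow> real" where
  "prq E = (\<Sum>y | y \<in> Y \<and> E y. q y)"

text \<open>\<open>D i\<close> is the player whose question in round \<open>i \<notin> C\<close> stays hidden; \<open>shown\<close> is the row of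
  round \<open>l\<close> with that entry masked. Given all masked rows, the questions of different players are
  independent.\<close>

definition shown :: "(nat \<Rightarrow> nat) \<Rightarrow> (nat \<Rightarrow> nat \<Rightarrow> 'q) \<Rightarrow> nat \<Rightarrow> nat \<Rightarrow> 'q" where
  "shown D y l = (\<lambda>t\<in>{..<k}. if l \<in> C \<or> t \<noteq> D l then y t l else undefined)"

definition answers_C :: "(nat \<Rightarrow> nat \<Rightarrow> 'q) \<Rightarrow> nat \<Rightarrow> nat \<Rightarrow> 'a" where
  "answers_C y = (\<lambda>l\<in>C. \<lambda>t\<in>{..<k}. f t (y t) l)"

definition info :: "(nat \<Rightarrow> nat) \<Rightarrow> (nat \<Rightarrow> nat \<Rightarrow> 'q) \<Rightarrow> (nat \<Rightarrow> nat \<Rightarrow> 'q) \<times> (nat \<Rightarrow> nat \<Rightarrow> 'a)" where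
  "info D y = (\<lambda>l\<in>{..<n}. shown D y l, answers_C y)"

text \<open>Row \<open>i\<close> is left out altogether, so the value does not depend on
  \<open>D i\<close>, and the player hidden in round \<open>i\<close> can be varied.\<close>

definition info_except :: "(nat \<Rightarrow> nat) \<Rightarrow> nat \<Rightarrow> (nat \<Rightarrow> nat \<Rightarrow> 'q) \<Rightarrow> (nat \<Rightarrow> nat \<Rightarrow> 'q) \<times> (nat \<Rightarrow> nat \<Rightarrow> 'a)" where
  "info_except D i y = (\<lambda>l\<in>{..<n} - {i}. shown D y l, answers_C y)"

text \<open>The Kullback-Leibler divergence, averaged over the conditioned law of \<open>info D\<close>, of the
  conditioned law of row \<open>i\<close> from its law under \<open>mu\<close> given the shown entries of that row.\<close>

definition kappa :: "(nat \<Rightarrow> nat) \<Rightarrow> nat \<Rightarrow> real" where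
  "kappa D i = (\<Sum>y\<in>Y. q y * ln (prq (\<lambda>y'. info D y' = info D y \<and> row y' i = row y i)
      / prq (\<lambda>y'. info D y' = info D y) * (marg_compl (D i) (row y i) / mu (row y i))))"

lemma q_nonneg: "0 \<le> q y"
  using win_C by (simp add: q_def P_nonneg)

lemma prq_nonneg: "0 \<le> prq E"
  by (simp add: prq_def sum_nonneg q_nonneg)

lemma q_le_prq: "y \<in> Y \<Longrightarrow> E y \<Longrightarrow> q y \<le> prq E"
  unfolding prq_def using finite_Y by (intro member_le_sum) (auto simp: q_nonneg)

lemma sum_q: "sum q Y = 1"
proof -
  have "sum q Y = (\<Sum>y | y \<in> Y \<and> (\<forall>i\<in>C. win i y). P y / win_on C)"
    unfolding q_def using finite_Y by (simp add: sum.inter_filter)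
  also have "\<dots> = win_on C / win_on C" by (simp add: win_on_def flip: sum_divide_distrib)
  finally show ?thesis using win_C by simp
qed

lemma mu_row_pos: "0 < q y \<Longrightarrow> i < n \<Longrightarrow> 0 < mu (row y i)"
proof -
  assume "0 < q y" "i < n"
  hence "P y \<noteq> 0" by (auto simp: q_def split: if_splits)
  hence "mu (row y i) \<noteq> 0" using \<open>i < n\<close> by (auto simp: P_def)
  thus ?thesis using mu_nonneg[of "row y i"] by simp
qed

lemma shown_eq_iff:
  "shown D y l = shown D y' l \<longleftrightarrow> (\<forall>t<k. l \<in> C \<or> t \<noteq> D l \<longrightarrow> y t l = y' t l)"
  by (auto simp: shown_def fun_eq_iff)

lemma shown_C: "l \<in> C \<Longrightarrow> shown D y l = row y l"
  by (auto simp: shown_def row_def fun_eq_iff)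

lemma shown_not_C: "l \<notin> C \<Longrightarrow> D l < k \<Longrightarrow> shown D y l = (row y l)(D l := undefined)"
  by (auto simp: shown_def row_def fun_eq_iff)

lemma info_eq_iff:
  "info D y = info D y' \<longleftrightarrow> (\<forall>l<n. shown D y l = shown D y' l) \<and> answers_C y = answers_C y'"
  by (auto simp: info_def fun_eq_iff restrict_def split: if_splits)

lemma info_except_eq_iff:
  "info_except D i y = info_except D i y'
    \<longleftrightarrow> (\<forall>l<n. l \<noteq> i \<longrightarrow> shown D y l = shown D y' l) \<and> answers_C y = answers_C y'"
  by (auto simp: info_except_def fun_eq_iff restrict_def split: if_splits)

lemma prq_sum_row:
  assumes "i < n"
  shows "(\<Sum>x\<in>Q. prq (\<lambda>y. E y \<and> row y i = x)) = prq E"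
proof -
  have "(\<Sum>x\<in>Q. prq (\<lambda>y. E y \<and> row y i = x)) = (\<Sum>x\<in>Q. \<Sum>y | y \<in> {y\<in>Y. E y} \<and> row y i = x. q y)"
    unfolding prq_def by (intro sum.cong refl) auto
  also have "\<dots> = prq E"
    unfolding prq_def using finite_Y finite_Q row_in_Q assms by (intro sum.group) auto
  finally show ?thesis .
qed

text \<open>On the support of \<open>q\<close> the summed logarithms equal
  \<open>ln (b y / q y) + ln (1 / win_on C)\<close> for a measure \<open>b\<close>, and Jensen's
  inequality leaves the logarithm of the mass of \<open>b\<close>. This mass is at most the number
  of possible answer lists on \<open>C\<close>: answers carry no weight of their own in
  \<open>b\<close> and are merely counted.\<close>

lemma sum_kappa_le:
  assumes D: "\<And>l. l < n \<Longrightarrow> D l < k"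
  shows "(\<Sum>i\<in>{..<n} - C. kappa D i) \<le> ln (1 / win_on C) + real (card C) * ln (real (card (PiE {..<k} A)))"
proof -
  define I where "I = {..<n} - C"
  define Yp where "Yp = {y\<in>Y. 0 < q y}"
  define cnd where "cnd = (\<lambda>y i. prq (\<lambda>y'. info D y' = info D y \<and> row y' i = row y i)
      / prq (\<lambda>y'. info D y' = info D y))"
  \<comment> \<open>\<open>mo i\<close> is the law under \<open>mu\<close> of the revealed part of
    row \<open>i\<close>, and \<open>M\<close> the law of all revealed parts together.\<close>
  define mo where "mo = (\<lambda>i \<xi>. if i \<in> C then mu \<xi> else \<Sum>x | x \<in> Q \<and> x(D i := undefined) = \<xi>. mu x)"
  define M where "M = (\<lambda>\<omega>. \<Prod>i<n. mo i (\<omega> i))"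
  \<comment> \<open>The revealed rows are weighted by their law under \<open>mu\<close>, then the
    rows outside \<open>C\<close> by the product of their conditioned laws given
    \<open>info D y\<close>.\<close>
  define b where "b = (\<lambda>y. (\<Prod>i\<in>I. cnd y i) * M (shown D y))"
  have finYp: "finite Yp" using finite_Y by (simp add: Yp_def)
  have I: "finite I" "{..<n} = C \<union> I" "C \<inter> I = {}" "finite C"
    using C by (auto simp: I_def intro: finite_subset)
  have mo_C: "mo i (shown D y i) = mu (row y i)" if "i \<in> C" for i y
    using that by (simp add: mo_def shown_C)
  have mo_I: "mo i (shown D y i) = marg_compl (D i) (row y i)" if "i \<in> I" "y \<in> Y" for i y
  proof -
    have "slice (D i) (row y i) = {x \<in> Q. x(D i := undefined) = shown D y i}"
      using that D row_in_Q mem_slice_iff[of "row y i" "D i"] by (auto simp: I_def shown_not_C)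
    thus ?thesis using that by (simp add: mo_def marg_compl_eq I_def)
  qed
  have pos: "0 < mu (row y i)" "0 < marg_compl (D i) (row y i)" "0 < cnd y i"
    if "y \<in> Yp" "i < n" for y i
  proof -
    have y: "y \<in> Y" "0 < q y" using that by (auto simp: Yp_def)
    show "0 < mu (row y i)" using mu_row_pos y that by blast
    thus "0 < marg_compl (D i) (row y i)"
      using mu_le_marg_compl[OF row_in_Q[OF y(1) that(2)], of "D i"] by simp
    show "0 < cnd y i" unfolding cnd_def
      using y q_le_prq[of y "\<lambda>y'. info D y' = info D y \<and> row y' i = row y i"]
        q_le_prq[of y "\<lambda>y'. info D y' = info D y"] by (intro divide_pos_pos) auto
  qed
  have M_pos: "0 < M (shown D y)" if "y \<in> Yp" for y
    unfolding M_def using that mo_C mo_I pos I(2)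
    by (intro prod_pos ballI) (metis (lifting) UnE Yp_def lessThan_iff mem_Collect_eq)
  have b_pos: "0 < b y" if "y \<in> Yp" for y
    unfolding b_def using pos M_pos that by (intro mult_pos_pos prod_pos) (auto simp: I_def)
  have term_eq: "(\<Sum>i\<in>I. ln (cnd y i * (marg_compl (D i) (row y i) / mu (row y i))))
      = ln (b y / q y) + ln (1 / win_on C)" if y: "y \<in> Yp" for y
  proof -
    have ps: "0 < cnd y i * (marg_compl (D i) (row y i) / mu (row y i))" if "i \<in> I" for i
      using pos[OF y, of i] that by (auto simp: I_def)
    have "(\<Sum>i\<in>I. ln (cnd y i * (marg_compl (D i) (row y i) / mu (row y i))))
        = ln (\<Prod>i\<in>I. cnd y i * (marg_compl (D i) (row y i) / mu (row y i)))"
      using I by (intro ln_prod[symmetric] less_imp_neq[OF ps, symmetric])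
    also have "(\<Prod>i\<in>I. cnd y i * (marg_compl (D i) (row y i) / mu (row y i)))
        = (\<Prod>i\<in>I. cnd y i) * ((\<Prod>i\<in>I. marg_compl (D i) (row y i)) / (\<Prod>i\<in>I. mu (row y i)))"
      by (simp add: prod.distrib prod_dividef)
    also have "(\<Prod>i\<in>I. marg_compl (D i) (row y i)) / (\<Prod>i\<in>I. mu (row y i)) = M (shown D y) / P y"
    proof -
      have "M (shown D y) = (\<Prod>i\<in>C. mu (row y i)) * (\<Prod>i\<in>I. marg_compl (D i) (row y i))"
        unfolding M_def I(2) using I y
        by (subst prod.union_disjoint) (auto simp: mo_C mo_I Yp_def intro!: arg_cong2[where f = "(*)"] prod.cong)
      moreover have "P y = (\<Prod>i\<in>C. mu (row y i)) * (\<Prod>i\<in>I. mu (row y i))"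
        unfolding P_def I(2) using I by (subst prod.union_disjoint) auto
      moreover have "0 < (\<Prod>i\<in>C. mu (row y i))" using pos y C by (intro prod_pos) auto
      ultimately show ?thesis by simp
    qed
    also have "(\<Prod>i\<in>I. cnd y i) * (M (shown D y) / P y) = b y / P y" by (simp add: b_def)
    also have "P y = q y * win_on C" using y win_C by (auto simp: Yp_def q_def split: if_splits)
    also have "ln (b y / (q y * win_on C)) = ln (b y / q y) + ln (1 / win_on C)"
      using b_pos[OF y] y win_C by (simp add: Yp_def ln_div ln_mult)
    finally show ?thesis .
  qed
  have sumYp: "(\<Sum>y\<in>Y. q y * h y) = (\<Sum>y\<in>Yp. q y * h y)" for h :: "_ \<Rightarrow> real"
    using finite_Y q_nonneg by (intro sum.mono_neutral_right) (auto simp: Yp_def order.order_iff_strict)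
  have sumq: "sum q Yp = 1" using sumYp[of "\<lambda>_. 1"] sum_q by simp
  have "(\<Sum>i\<in>I. kappa D i) = (\<Sum>y\<in>Y. q y * (\<Sum>i\<in>I. ln (cnd y i * (marg_compl (D i) (row y i) / mu (row y i)))))"
    unfolding kappa_def cnd_def sum_distrib_left by (rule sum.swap)
  also have "\<dots> = (\<Sum>y\<in>Yp. q y * (ln (b y / q y) + ln (1 / win_on C)))"
    unfolding sumYp using term_eq by (intro sum.cong) auto
  also have "\<dots> = (\<Sum>y\<in>Yp. q y * ln (b y / q y)) + ln (1 / win_on C)"
    by (simp add: distrib_left sum.distrib sumq flip: sum_distrib_right)
  also have "(\<Sum>y\<in>Yp. q y * ln (b y / q y)) \<le> ln (real (card (PiE {..<k} A)) ^ card C)"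
  proof (rule sum_mult_ln_ratio_le[OF finYp _ b_pos sumq])
    define OM where "OM = PiE {..<n} (\<lambda>i. if i \<in> C then Q else (\<lambda>x. x(D i := undefined)) ` Q)"
    define AC where "AC = PiE C (\<lambda>_. PiE {..<k} A)"
    have finOM: "finite OM" unfolding OM_def using finite_Q by (intro finite_PiE) auto
    have finAC: "finite AC" unfolding AC_def using I finite_A by (intro finite_PiE) auto
    have M_nonneg: "0 \<le> M \<omega>" for \<omega>
      unfolding M_def mo_def by (intro prod_nonneg) (auto intro: mu_nonneg sum_nonneg)
    have fibre: "(\<Sum>y | y \<in> Yp \<and> info D y = z. b y) \<le> M (fst z)" if z: "z \<in> info D ` Yp" for z
    proof -
      obtain y0 where y0: "y0 \<in> Yp" "z = info D y0" using z by blast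
      define c where "c = (\<lambda>i x. prq (\<lambda>y'. info D y' = z \<and> row y' i = x) / prq (\<lambda>y'. info D y' = z))"
      let ?F = "{y. y \<in> Yp \<and> info D y = z}"
      let ?r = "\<lambda>y. \<lambda>i\<in>I. row y i"
      have Mz: "M (shown D y) = M (fst z)" if "info D y = z" for y
        unfolding M_def that[symmetric] info_def by (intro prod.cong) auto
      \<comment> \<open>On a fibre of \<open>info D\<close> the rows outside \<open>C\<close>
        determine \<open>y\<close>, so the sum of \<open>b\<close> is part of a sum of products of
        probability laws.\<close>
      have inj: "inj_on ?r ?F"
      proof (rule inj_onI)
        fix y y' assume y: "y \<in> ?F" "y' \<in> ?F" "?r y = ?r y'"
        show "y = y'"
        proof (rule Y_eqI)
          fix i t assume it: "i < n" "t < k"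
          show "y t i = y' t i"
          proof (cases "i \<in> C")
            case True
            have "info D y = info D y'" using y by simp
            thus ?thesis using True it by (auto simp: info_eq_iff shown_eq_iff)
          next
            case False
            thus ?thesis using it fun_cong[OF fun_cong[OF y(3), of i], of t] by (simp add: row_def I_def)
          qed
        qed (use y in \<open>auto simp: Yp_def\<close>)
      qed
      have "(\<Sum>y\<in>?F. b y) = (\<Sum>y\<in>?F. (\<Prod>i\<in>I. c i (?r y i)) * M (fst z))"
        unfolding b_def cnd_def c_def by (intro sum.cong refl) (auto simp: Mz)
      also have "\<dots> = (\<Sum>x\<in>?r ` ?F. \<Prod>i\<in>I. c i (x i)) * M (fst z)"
        unfolding sum.reindex[OF inj] by (simp flip: sum_distrib_right)
      also have "\<dots> \<le> (\<Sum>x\<in>PiE I (\<lambda>_. Q). \<Prod>i\<in>I. c i (x i)) * M (fst z)"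
      proof (intro mult_right_mono sum_mono2 M_nonneg)
        show "?r ` ?F \<subseteq> PiE I (\<lambda>_. Q)" by (simp add: image_subset_iff row_in_Q Yp_def I_def)
        show "finite (PiE I (\<lambda>_. Q))" using I by (auto intro!: finite_PiE finite_X)
      qed (auto simp: c_def intro!: prod_nonneg divide_nonneg_nonneg prq_nonneg)
      also have "(\<Sum>x\<in>PiE I (\<lambda>_. Q). \<Prod>i\<in>I. c i (x i)) = (\<Prod>i\<in>I. \<Sum>x\<in>Q. c i x)"
        using I finite_Q by (intro prod_sum_PiE[symmetric]) auto
      also have "\<dots> = 1"
      proof (intro prod.neutral ballI)
        fix i assume i: "i \<in> I"
        have "0 < prq (\<lambda>y'. info D y' = z)"
          using q_le_prq[of y0 "\<lambda>y'. info D y' = z"] y0 by (auto simp: Yp_def)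
        thus "(\<Sum>x\<in>Q. c i x) = 1"
          unfolding c_def using prq_sum_row[of i "\<lambda>y'. info D y' = z"] i
          by (simp add: I_def flip: sum_divide_distrib)
      qed
      finally show ?thesis by simp
    qed
    have "(\<Sum>y\<in>Yp. b y) = (\<Sum>z\<in>info D ` Yp. \<Sum>y | y \<in> Yp \<and> info D y = z. b y)"
      by (rule sum.image_gen[OF finYp])
    also have "\<dots> \<le> (\<Sum>z\<in>info D ` Yp. M (fst z))" using fibre by (rule sum_mono)
    also have "\<dots> \<le> (\<Sum>z\<in>OM \<times> AC. M (fst z))"
    proof (rule sum_mono2)
      show "info D ` Yp \<subseteq> OM \<times> AC"
        using D row_in_Q answer_in_A C
        by (auto simp: info_def OM_def AC_def Yp_def answers_C_def shown_C shown_not_C)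
    qed (use finOM finAC M_nonneg in auto)
    also have "\<dots> = real (card AC) * (\<Sum>\<omega>\<in>OM. M \<omega>)"
      by (simp add: sum.cartesian_product' sum_distrib_left)
    also have "(\<Sum>\<omega>\<in>OM. M \<omega>) = (\<Prod>i<n. \<Sum>\<xi>\<in>(if i \<in> C then Q else (\<lambda>x. x(D i := undefined)) ` Q). mo i \<xi>)"
      unfolding OM_def M_def using finite_Q by (intro prod_sum_PiE[symmetric]) auto
    also have "\<dots> = 1"
    proof (intro prod.neutral ballI)
      fix i
      show "(\<Sum>\<xi>\<in>(if i \<in> C then Q else (\<lambda>x. x(D i := undefined)) ` Q). mo i \<xi>) = 1"
        using sum.image_gen[OF finite_Q, of mu "\<lambda>x. x(D i := undefined)"]
        by (simp add: mo_def sum_mu)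
    qed
    finally show "sum b Yp \<le> real (card (PiE {..<k} A)) ^ card C"
      using I by (simp add: AC_def card_PiE)
  qed (simp add: Yp_def)
  also have "ln (real (card (PiE {..<k} A)) ^ card C) = real (card C) * ln (real (card (PiE {..<k} A)))"
  proof -
    have "card (PiE {..<k} A) \<noteq> 0"
      using finite_A A_nonempty by (simp add: card_PiE)
    thus ?thesis by (simp add: ln_realpow)
  qed
  finally show ?thesis by (simp add: I_def)
qed

end

section \<open>Closeness to a product law\<close>

context conditioned_game
begin

abbreviation rounds where "rounds \<equiv> {..<n} - C"

text \<open>For fixed \<open>r\<close> this is an unnormalised measure on \<open>Q\<close>, to which
  the Gibbs sampler applies; its mass is the conditioned probability of \<open>r\<close>.\<close>

definition nu :: "(nat \<Rightarrow> nat) \<Rightarrow> nat \<Rightarrow> (nat \<Rightarrow> nat \<Rightarrow> 'q) \<times> (nat \<Rightarrow> nat \<Rightarrow> 'a) \<Rightarrow> (nat \<Rightarrow> 'q) \<Rightarrow> real" where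
  "nu D i r x = prq (\<lambda>y. info_except D i y = r \<and> row y i = x)"

text \<open>With player \<open>t\<close> hidden in round \<open>i\<close>, row \<open>i\<close> is
  known exactly up to its slice in direction \<open>t\<close>. This turns conditioning on
  \<open>info\<close> into the slice sums of a Gibbs step.\<close>

lemma info_upd_eq_iff:
  assumes "i \<in> rounds" "y' \<in> Y"
  shows "info (D(i := t)) y' = info (D(i := t)) y
    \<longleftrightarrow> info_except D i y' = info_except D i y \<and> row y' i \<in> slice t (row y i)"
proof -
  have "(\<forall>l<n. shown (D(i := t)) y' l = shown (D(i := t)) y l)
    \<longleftrightarrow> (\<forall>l<n. l \<noteq> i \<longrightarrow> shown D y' l = shown D y l) \<and> (\<forall>s<k. s \<noteq> t \<longrightarrow> y' s i = y s i)"
    using assms by (auto simp: shown_eq_iff)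
  moreover have "row y' i \<in> slice t (row y i) \<longleftrightarrow> (\<forall>s<k. s \<noteq> t \<longrightarrow> y' s i = y s i)"
    using assms row_in_Q[of y' i] by (auto simp: slice_def row_def)
  ultimately show ?thesis by (auto simp: info_eq_iff info_except_eq_iff)
qed

lemma nu_nonneg: "0 \<le> nu D i r x"
  by (simp add: nu_def prq_nonneg)

lemma supported_nu:
  assumes "i < n"
  shows "supported (nu D i r)"
  unfolding supported_def
proof (intro ballI impI)
  fix x assume "mu x = 0"
  hence "q y = 0" if "row y i = x" for y
    using mu_row_pos[of y i] q_nonneg[of y] that assms by (auto simp: order.order_iff_strict)
  thus "nu D i r x = 0" by (auto simp: nu_def prq_def)
qed

lemma sum_nu_slice:
  assumes i: "i \<in> rounds" and y: "y \<in> Y"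
  shows "sum (nu D i (info_except D i y)) (slice t (row y i))
       = prq (\<lambda>y'. info (D(i := t)) y' = info (D(i := t)) y)"
proof -
  let ?F = "{y'. y' \<in> Y \<and> info (D(i := t)) y' = info (D(i := t)) y}"
  have "sum (nu D i (info_except D i y)) (slice t (row y i))
      = (\<Sum>x\<in>slice t (row y i). \<Sum>y' | y' \<in> ?F \<and> row y' i = x. q y')"
    unfolding nu_def prq_def using info_upd_eq_iff[OF i] by (intro sum.cong refl) auto
  also have "\<dots> = prq (\<lambda>y'. info (D(i := t)) y' = info (D(i := t)) y)"
    unfolding prq_def using finite_Y finite_slice info_upd_eq_iff[OF i] by (intro sum.group) auto
  finally show ?thesis .
qed

lemma prq_group:
  assumes "i < n"
  shows "(\<Sum>r\<in>info_except D i ` Y. \<Sum>x\<in>Q. prq (\<lambda>y. info_except D i y = r \<and> row y i = x \<and> E y)) = prq E"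
proof -
  have "(\<Sum>r\<in>info_except D i ` Y. \<Sum>x\<in>Q. prq (\<lambda>y. info_except D i y = r \<and> row y i = x \<and> E y))
      = (\<Sum>r\<in>info_except D i ` Y. prq (\<lambda>y. info_except D i y = r \<and> E y))"
  proof (intro sum.cong refl)
    fix r
    show "(\<Sum>x\<in>Q. prq (\<lambda>y. info_except D i y = r \<and> row y i = x \<and> E y)) = prq (\<lambda>y. info_except D i y = r \<and> E y)"
      using prq_sum_row[OF assms, of "\<lambda>y. info_except D i y = r \<and> E y"] by (simp add: conj_ac)
  qed
  also have "\<dots> = (\<Sum>r\<in>info_except D i ` Y. \<Sum>y | y \<in> {y\<in>Y. E y} \<and> info_except D i y = r. q y)"
    unfolding prq_def by (intro sum.cong refl) auto
  also have "\<dots> = prq E"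
    unfolding prq_def using finite_Y by (intro sum.group) auto
  finally show ?thesis .
qed

lemma sum_nu:
  assumes "i < n"
  shows "(\<Sum>r\<in>info_except D i ` Y. sum (nu D i r) Q) = 1"
  using prq_group[OF assms, of D "\<lambda>_. True"] sum_q by (simp add: nu_def prq_def)

text \<open>By \<open>sum_nu_slice\<close> the ratio of \<open>nu D i r x\<close> to its resampled
  value is the argument of the logarithm in \<open>kappa (D(i := t)) i\<close>. The latter is thus
  the divergence of the joint law of \<open>r\<close> and row \<open>i\<close> from its image under
  the Gibbs step, and \<open>L1_sq_le_KL\<close> applies.\<close>

lemma L1_nu_resample_le:
  assumes i: "i \<in> rounds" and t: "t < k"
  shows "(\<Sum>r\<in>info_except D i ` Y. L1 (\<lambda>x. nu D i r x - resample t (nu D i r) x))\<^sup>2 \<le> 4 * kappa (D(i := t)) i"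
proof -
  let ?S = "info_except D i ` Y \<times> Q"
  define p where "p = (\<lambda>(r, x). nu D i r x)"
  define p' where "p' = (\<lambda>(r, x). resample t (nu D i r) x)"
  have i': "i < n" using i by simp
  have fin: "finite ?S" using finite_Y finite_Q by simp
  have "(\<Sum>z\<in>?S. p z * ln (p z / p' z)) = (\<Sum>z\<in>?S. \<Sum>y | y \<in> Y \<and> (info_except D i y, row y i) = z. q y * ln (p z / p' z))"
  proof (intro sum.cong refl)
    fix z
    have "p z = (\<Sum>y | y \<in> Y \<and> (info_except D i y, row y i) = z. q y)"
      by (cases z) (simp add: p_def nu_def prq_def)
    thus "p z * ln (p z / p' z) = (\<Sum>y | y \<in> Y \<and> (info_except D i y, row y i) = z. q y * ln (p z / p' z))"
      by (simp only: sum_distrib_right)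
  qed
  also have "\<dots> = (\<Sum>z\<in>?S. \<Sum>y | y \<in> Y \<and> (info_except D i y, row y i) = z.
        q y * ln (p (info_except D i y, row y i) / p' (info_except D i y, row y i)))"
    by (intro sum.cong refl) auto
  also have "\<dots> = (\<Sum>y\<in>Y. q y * ln (p (info_except D i y, row y i) / p' (info_except D i y, row y i)))"
    using fin finite_Y row_in_Q i' by (intro sum.group) auto
  also have "\<dots> = kappa (D(i := t)) i"
    unfolding kappa_def
  proof (intro sum.cong refl arg_cong2[where f = "(*)"] arg_cong[where f = ln])
    fix y assume y: "y \<in> Y"
    have "y' \<in> Y \<and> info_except D i y' = info_except D i y \<and> row y' i = row y i
        \<longleftrightarrow> y' \<in> Y \<and> info (D(i := t)) y' = info (D(i := t)) y \<and> row y' i = row y i" for y'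
      using info_upd_eq_iff[OF i, of y' D t y] slice_refl[OF row_in_Q[OF y i'], of t] by metis
    hence "p (info_except D i y, row y i)
        = prq (\<lambda>y'. info (D(i := t)) y' = info (D(i := t)) y \<and> row y' i = row y i)"
      by (simp only: p_def nu_def prq_def prod.case)
    moreover have "p' (info_except D i y, row y i)
        = mu (row y i) / marg_compl t (row y i) * prq (\<lambda>y'. info (D(i := t)) y' = info (D(i := t)) y)"
      by (simp add: p'_def resample_def sum_nu_slice[OF i y])
    ultimately show "p (info_except D i y, row y i) / p' (info_except D i y, row y i)
        = prq (\<lambda>y'. info (D(i := t)) y' = info (D(i := t)) y \<and> row y' i = row y i)
          / prq (\<lambda>y'. info (D(i := t)) y' = info (D(i := t)) y)
          * (marg_compl ((D(i := t)) i) (row y i) / mu (row y i))"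
      by simp
  qed
  finally have kl: "(\<Sum>z\<in>?S. p z * ln (p z / p' z)) = kappa (D(i := t)) i" .
  have "(\<Sum>z\<in>?S. \<bar>p z - p' z\<bar>)\<^sup>2 \<le> 4 * (\<Sum>z\<in>?S. p z * ln (p z / p' z))"
  proof (rule L1_sq_le_KL[OF fin])
    fix z assume z: "z \<in> ?S"
    obtain r x where rx: "z = (r, x)" "x \<in> Q" using z by auto
    show "0 \<le> p z" by (simp add: p_def rx nu_nonneg)
    show "0 \<le> p' z" by (simp add: p'_def rx resample_nonneg nu_nonneg)
    show "0 < p' z" if "0 < p z"
    proof -
      have "0 < nu D i r x" using that by (simp add: p_def rx)
      moreover have "nu D i r x \<le> sum (nu D i r) (slice t x)"
        using slice_refl[OF rx(2)] finite_slice by (intro member_le_sum) (auto simp: nu_nonneg)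
      moreover have "0 < mu x"
        using \<open>0 < nu D i r x\<close> supported_nu[OF i', of D r] rx(2) mu_nonneg[of x]
        by (auto simp: supported_def order.order_iff_strict)
      ultimately show ?thesis
        using mu_le_marg_compl[OF rx(2), of t] by (auto simp: p'_def rx resample_def)
    qed
  next
    show "sum p ?S = 1" using sum_nu[OF i', of D] by (simp add: p_def sum.cartesian_product)
    show "sum p' ?S \<le> 1"
      using sum_nu[OF i', of D] sum_resample[OF supported_nu[OF i']]
      by (simp add: p'_def flip: sum.cartesian_product)
  qed
  moreover have "(\<Sum>z\<in>?S. \<bar>p z - p' z\<bar>) = (\<Sum>r\<in>info_except D i ` Y. L1 (\<lambda>x. nu D i r x - resample t (nu D i r) x))"
    unfolding L1_def p_def p'_def sum.cartesian_product by (intro sum.cong) auto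
  ultimately show ?thesis by (simp add: kl)
qed

text \<open>Given the shared information \<open>r\<close>, every player can simulate the columns of the conditioned
  law from the own question of round \<open>i\<close> alone.\<close>

lemma fibre_win_le_val:
  assumes D: "\<And>l. l < n \<Longrightarrow> D l < k" and i: "i \<in> rounds"
    and y0: "y0 \<in> Y" and W: "\<forall>l\<in>C. win l y0" and r: "r = info_except D i y0"
  shows "(\<Sum>x\<in>Q. mu x * (prq (\<lambda>y. info_except D i y = r \<and> row y i = x \<and> win i y) / nu D i r x))
    \<le> val k X A mu V"
proof -
  \<comment> \<open>The columns of player \<open>t\<close> compatible with \<open>r\<close>: free
    are only the entry of round \<open>i\<close> and those of rounds hiding \<open>t\<close>, and
    the answers on \<open>C\<close> are prescribed. Each condition concerns one player, so the fibre
    of \<open>r\<close> is a product set.\<close>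
  define S where "S = (\<lambda>t. {c \<in> rep_Q n X t. (\<forall>l<n. l \<noteq> i \<and> (l \<in> C \<or> t \<noteq> D l) \<longrightarrow> c l = y0 t l)
      \<and> (\<forall>l\<in>C. f t c l = f t (y0 t) l)})"
  define L where "L = rounds - {i}"
  \<comment> \<open>On the fibre, \<open>mu\<close> of a round \<open>l\<close> in \<open>L\<close>
    depends only on the hidden entry of player \<open>D l\<close>; apart from the factor of row
    \<open>i\<close>, the weight therefore factorises over the players.\<close>
  define G where "G = (\<lambda>l u. mu ((row y0 l)(D l := u)))"
  define om where "om = (\<lambda>t c. \<Prod>l | l \<in> L \<and> D l = t. G l (c l))"
  define K where "K = (\<Prod>l\<in>C. mu (row y0 l)) / win_on C"
  define tot where "tot = (\<lambda>t u. \<Sum>c | c \<in> S t \<and> c i = u. om t c)"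
  \<comment> \<open>The law of the column given its entry \<open>u\<close> in round
    \<open>i\<close>; if no column with this entry has positive weight, the default
    \<open>y0 t\<close> keeps it a probability.\<close>
  define \<pi> where "\<pi> = (\<lambda>t u c. if tot t u = 0 then of_bool (c = y0 t)
      else if c i = u then om t c / tot t u else 0 :: real)"
  let ?g = "\<lambda>t c. f t c i"
  let ?h = "\<lambda>x y. of_bool (V x (\<lambda>t\<in>{..<k}. ?g t (y t))) :: real"
  let ?S = "\<lambda>x t. {c \<in> S t. c i = x t}"
  have i': "i < n" using i by simp
  have finS: "finite (S t)" if "t < k" for t
  proof (rule finite_subset)
    show "S t \<subseteq> PiE {..<n} (\<lambda>_. X t)" by (auto simp: S_def rep_Q_def)
  qed (use finite_X[OF that] in \<open>auto intro: finite_PiE\<close>)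
  have y0S: "y0 t \<in> S t" if "t < k" for t using y0 that by (auto simp: S_def)
  have om_nonneg: "0 \<le> om t c" for t c unfolding om_def G_def by (intro prod_nonneg ballI mu_nonneg)
  have tot_nonneg: "0 \<le> tot t u" for t u unfolding tot_def by (intro sum_nonneg om_nonneg)
  have ans: "answers_C y = answers_C y0 \<longleftrightarrow> (\<forall>l\<in>C. \<forall>t<k. f t (y t) l = f t (y0 t) l)" for y
    by (auto simp: answers_C_def fun_eq_iff restrict_def)
  have fib: "y \<in> Y \<and> info_except D i y = r \<longleftrightarrow> y \<in> PiE {..<k} S" for y
    unfolding r info_except_eq_iff ans shown_eq_iff by (auto simp: S_def PiE_iff)
  have q_fib: "q y = mu (row y i) * K * (\<Prod>t<k. om t (y t))" if y: "y \<in> PiE {..<k} S" for y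
  proof -
    have yS: "y t l = y0 t l" if "t < k" "l < n" "l \<noteq> i" "l \<in> C \<or> t \<noteq> D l" for t l
      using PiE_mem[OF y, of t] that by (auto simp: S_def)
    have ra: "f t (y t) l = f t (y0 t) l" if "t < k" "l \<in> C" for t l
      using PiE_mem[OF y, of t] that by (auto simp: S_def)
    have rC: "row y l = row y0 l" if l: "l \<in> C" for l
    proof -
      have "l < n" "l \<noteq> i" using l C i by auto
      thus ?thesis using yS l by (auto simp: row_def fun_eq_iff)
    qed
    have rL: "row y l = (row y0 l)(D l := y (D l) l)" if l: "l \<in> L" for l
      using yS l D by (auto simp: row_def fun_eq_iff L_def)
    have "win l y \<longleftrightarrow> win l y0" if l: "l \<in> C" for l
    proof -
      have "(\<lambda>t\<in>{..<k}. f t (y t) l) = (\<lambda>t\<in>{..<k}. f t (y0 t) l)" using ra l by (auto simp: fun_eq_iff)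
      thus ?thesis by (simp add: win_def rC[OF l])
    qed
    hence q: "q y = P y / win_on C" using W by (simp add: q_def)
    have "{..<n} = insert i (C \<union> L)" "i \<notin> C \<union> L" "C \<inter> L = {}" "finite C" "finite L"
      using C i by (auto simp: L_def intro: finite_subset)
    hence "P y = mu (row y i) * ((\<Prod>l\<in>C. mu (row y l)) * (\<Prod>l\<in>L. mu (row y l)))"
      unfolding P_def by (simp add: prod.union_disjoint)
    also have "(\<Prod>l\<in>C. mu (row y l)) = (\<Prod>l\<in>C. mu (row y0 l))" using rC by simp
    also have "(\<Prod>l\<in>L. mu (row y l)) = (\<Prod>l\<in>L. G l (y (D l) l))"
      by (intro prod.cong refl) (simp add: rL G_def)
    also have "\<dots> = (\<Prod>t<k. \<Prod>l | l \<in> L \<and> D l = t. G l (y (D l) l))"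
      using D by (intro prod.group[symmetric]) (auto simp: L_def)
    also have "\<dots> = (\<Prod>t<k. om t (y t))"
      unfolding om_def by (intro prod.cong refl) auto
    finally show ?thesis unfolding q K_def by simp
  qed
  have rowx: "{y. y \<in> PiE {..<k} S \<and> row y i = x} = PiE {..<k} (?S x)" if x: "x \<in> Q" for x
  proof (intro equalityI subsetI)
    fix y assume "y \<in> {y. y \<in> PiE {..<k} S \<and> row y i = x}"
    thus "y \<in> PiE {..<k} (?S x)" by (auto simp: PiE_iff row_def)
  next
    fix y assume y: "y \<in> PiE {..<k} (?S x)"
    have "row y i = x" unfolding row_def
      using y x by (auto simp: fun_eq_iff PiE_iff extensional_def)
    thus "y \<in> {y. y \<in> PiE {..<k} S \<and> row y i = x}" using y by (auto simp: PiE_iff)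
  qed
  have num: "prq (\<lambda>y. info_except D i y = r \<and> row y i = x \<and> win i y)
      = mu x * K * (\<Sum>y\<in>PiE {..<k} (?S x). (\<Prod>t<k. om t (y t)) * ?h x y)" if x: "x \<in> Q" for x
  proof -
    have "prq (\<lambda>y. info_except D i y = r \<and> row y i = x \<and> win i y)
        = (\<Sum>y | y \<in> {y. y \<in> PiE {..<k} S \<and> row y i = x} \<and> win i y. q y)"
      unfolding prq_def using fib by (intro sum.cong refl) auto
    also have "\<dots> = (\<Sum>y | y \<in> PiE {..<k} S \<and> row y i = x. if win i y then q y else 0)"
    proof (rule sum.inter_filter)
      show "finite {y. y \<in> PiE {..<k} S \<and> row y i = x}"
        by (rule finite_subset[of _ "PiE {..<k} S"]) (auto intro!: finite_PiE finS)
    qed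
    also have "\<dots> = (\<Sum>y | y \<in> PiE {..<k} S \<and> row y i = x. mu x * K * ((\<Prod>t<k. om t (y t)) * ?h x y))"
      by (intro sum.cong refl) (auto simp: q_fib win_def)
    finally show ?thesis unfolding rowx[OF x] sum_distrib_left .
  qed
  have den: "nu D i r x = mu x * K * (\<Prod>t<k. tot t (x t))" if x: "x \<in> Q" for x
  proof -
    have "nu D i r x = (\<Sum>y | y \<in> PiE {..<k} S \<and> row y i = x. q y)"
      unfolding nu_def prq_def using fib by (intro sum.cong refl) auto
    also have "\<dots> = (\<Sum>y | y \<in> PiE {..<k} S \<and> row y i = x. mu x * K * (\<Prod>t<k. om t (y t)))"
      by (intro sum.cong refl) (auto simp: q_fib)
    also have "\<dots> = mu x * K * (\<Sum>y\<in>PiE {..<k} (?S x). \<Prod>t<k. om t (y t))"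
      unfolding rowx[OF x] sum_distrib_left ..
    also have "(\<Sum>y\<in>PiE {..<k} (?S x). \<Prod>t<k. om t (y t)) = (\<Prod>t<k. tot t (x t))"
      unfolding tot_def using finS by (intro prod_sum_PiE[symmetric]) auto
    finally show ?thesis .
  qed
  have pi_nonneg: "0 \<le> \<pi> t u c" for t u c
    by (simp add: \<pi>_def om_nonneg tot_nonneg)
  have "(\<Sum>x\<in>Q. mu x * (prq (\<lambda>y. info_except D i y = r \<and> row y i = x \<and> win i y) / nu D i r x))
      \<le> (\<Sum>x\<in>Q. mu x * (\<Sum>c\<in>PiE {..<k} S. (\<Prod>t<k. \<pi> t (x t) (c t)) * ?h x c))"
  proof (intro sum_mono mult_left_mono mu_nonneg)
    fix x assume x: "x \<in> Q"
    show "prq (\<lambda>y. info_except D i y = r \<and> row y i = x \<and> win i y) / nu D i r x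
        \<le> (\<Sum>c\<in>PiE {..<k} S. (\<Prod>t<k. \<pi> t (x t) (c t)) * ?h x c)"
    \<comment> \<open>In the first case division by zero makes the left-hand side 0; in the second
      the factor \<open>mu x * K\<close> cancels.\<close>
    proof (cases "nu D i r x = 0")
      case True
      thus ?thesis by (simp add: sum_nonneg prod_nonneg pi_nonneg)
    next
      case False
      hence nz: "mu x * K \<noteq> 0" "tot t (x t) \<noteq> 0" if "t < k" for t
        using that unfolding den[OF x] by auto
      have "prq (\<lambda>y. info_except D i y = r \<and> row y i = x \<and> win i y) / nu D i r x
          = (\<Sum>y\<in>PiE {..<k} (?S x). (\<Prod>t<k. om t (y t)) * ?h x y) / (\<Prod>t<k. tot t (x t))"
        unfolding num[OF x] den[OF x] using nz(1)[OF k_pos] by simp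
      also have "\<dots> = (\<Sum>y\<in>PiE {..<k} (?S x). (\<Prod>t<k. \<pi> t (x t) (y t)) * ?h x y)"
        unfolding sum_divide_distrib
      proof (intro sum.cong refl)
        fix y assume y: "y \<in> PiE {..<k} (?S x)"
        have "(\<Prod>t<k. \<pi> t (x t) (y t)) = (\<Prod>t<k. om t (y t) / tot t (x t))"
          using y nz(2) by (intro prod.cong refl) (auto simp: \<pi>_def PiE_iff)
        thus "(\<Prod>t<k. om t (y t)) * ?h x y / (\<Prod>t<k. tot t (x t)) = (\<Prod>t<k. \<pi> t (x t) (y t)) * ?h x y"
          by (simp add: prod_dividef)
      qed
      also have "\<dots> \<le> (\<Sum>c\<in>PiE {..<k} S. (\<Prod>t<k. \<pi> t (x t) (c t)) * ?h x c)"
      proof (rule sum_mono2)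
        show "finite (PiE {..<k} S)" by (auto intro!: finite_PiE finS)
      qed (auto simp: PiE_iff intro!: prod_nonneg pi_nonneg)
      finally show ?thesis .
    qed
  qed
  also have "\<dots> \<le> val k X A mu V"
  proof (rule mixed_strategy_le_val[OF finS _ pi_nonneg])
    fix t c assume t: "t < k" and c: "c \<in> S t"
    have "f t \<in> rep_Q n X t \<rightarrow>\<^sub>E rep_A n A t" using f t by (auto simp: strategies_def)
    moreover have "c \<in> rep_Q n X t" using c by (simp add: S_def)
    ultimately have "f t c \<in> rep_A n A t" by auto
    thus "f t c i \<in> A t" using i' by (auto simp: rep_A_def)
  next
    fix t u assume t: "t < k"
    show "(\<Sum>c\<in>S t. \<pi> t u c) = 1"
    proof (cases "tot t u = 0")
      case True
      thus ?thesis using finS[OF t] y0S[OF t] by (simp add: \<pi>_def of_bool_def sum.delta)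
    next
      case False
      hence "(\<Sum>c\<in>S t. \<pi> t u c) = (\<Sum>c\<in>S t. if c i = u then om t c / tot t u else 0)"
        by (simp add: \<pi>_def)
      also have "\<dots> = (\<Sum>c | c \<in> S t \<and> c i = u. om t c / tot t u)"
        using finS[OF t] by (simp add: sum.inter_filter)
      also have "\<dots> = tot t u / tot t u" by (simp add: tot_def flip: sum_divide_distrib)
      finally show ?thesis using False by simp
    qed
  qed
  finally show ?thesis .
qed

lemma prq_win: "i \<in> rounds \<Longrightarrow> prq (win i) = win_on (insert i C) / win_on C"
proof -
  have "prq (win i) = (\<Sum>y | y \<in> Y \<and> win i y. if \<forall>l\<in>C. win l y then P y / win_on C else 0)"
    by (simp add: prq_def q_def)
  also have "\<dots> = (\<Sum>y | y \<in> {y\<in>Y. win i y} \<and> (\<forall>l\<in>C. win l y). P y / win_on C)"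
    using finite_Y by (intro sum.inter_filter[symmetric]) auto
  also have "\<dots> = (\<Sum>y | y \<in> Y \<and> (\<forall>l\<in>insert i C. win l y). P y) / win_on C"
    unfolding sum_divide_distrib by (intro sum.cong refl) auto
  finally show ?thesis by (simp only: win_on_def)
qed

text \<open>On each fibre of \<open>info_except D i\<close> the law of row \<open>i\<close> is
  replaced by the multiple of \<open>mu\<close> of equal mass. This costs at most the
  \<open>L1\<close> distance, as conditional winning probabilities lie between 0 and 1; afterwards
  \<open>fibre_win_le_val\<close> bounds every fibre of positive mass.\<close>

lemma win_insert_le:
  assumes D: "\<And>l. l < n \<Longrightarrow> D l < k" and i: "i \<in> rounds"
  shows "win_on (insert i C) / win_on C \<le> val k X A mu V
    + (\<Sum>r\<in>info_except D i ` Y. L1 (\<lambda>x. nu D i r x - mu x * sum (nu D i r) Q))"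
proof -
  let ?RS = "info_except D i ` Y"
  let ?v = "val k X A mu V"
  define num where "num = (\<lambda>r x. prq (\<lambda>y. info_except D i y = r \<and> row y i = x \<and> win i y))"
  define h where "h = (\<lambda>r x. num r x / nu D i r x)"
  define N where "N = (\<lambda>r. sum (nu D i r) Q)"
  have i': "i < n" using i by simp
  have num: "0 \<le> num r x" "num r x \<le> nu D i r x" for r x
    unfolding num_def nu_def using prq_nonneg finite_Y
    by (auto simp: prq_def q_nonneg intro!: sum_mono2 sum_nonneg)
  have h: "0 \<le> h r x" "h r x \<le> 1" "num r x = nu D i r x * h r x" for r x
    using num[of r x] nu_nonneg[of D i r x] by (auto simp: h_def divide_le_eq_1 order.order_iff_strict)
  have N_nonneg: "0 \<le> N r" for r by (simp add: N_def sum_nonneg nu_nonneg)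
  have fib: "N r * (\<Sum>x\<in>Q. mu x * h r x) \<le> N r * ?v" if r: "r \<in> ?RS" for r
  proof -
    obtain y0 where y0: "y0 \<in> Y" "r = info_except D i y0" using r by blast
    show ?thesis
    proof (cases "\<forall>l\<in>C. win l y0")
      case True
      show ?thesis using fibre_win_le_val[of D, OF D i y0(1) True y0(2)] N_nonneg
        by (intro mult_left_mono) (auto simp: h_def num_def)
    next
      case False
      \<comment> \<open>The rows and answers of \<open>C\<close> are part of \<open>r\<close>, so
        the whole fibre loses round \<open>l\<close> and has conditioned mass 0.\<close>
      then obtain l where l: "l \<in> C" "\<not> win l y0" by blast
      have ln: "l < n" "l \<noteq> i" using l C i by auto
      have "q y = 0" if "info_except D i y = r" for y
      proof -
        have "shown D y l = shown D y0 l" "answers_C y = answers_C y0"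
          using that ln unfolding y0(2) info_except_eq_iff by auto
        hence "row y l = row y0 l" "answers_C y l = answers_C y0 l" using l by (auto simp: shown_C)
        hence "row y l = row y0 l" "(\<lambda>t\<in>{..<k}. f t (y t) l) = (\<lambda>t\<in>{..<k}. f t (y0 t) l)"
          using l by (auto simp: answers_C_def)
        hence "\<not> win l y" using l by (simp add: win_def)
        thus ?thesis using l by (auto simp: q_def)
      qed
      hence "N r = 0" by (auto simp: N_def nu_def prq_def)
      thus ?thesis by simp
    qed
  qed
  have "win_on (insert i C) / win_on C = (\<Sum>r\<in>?RS. \<Sum>x\<in>Q. num r x)"
    unfolding prq_win[OF i, symmetric] num_def by (rule prq_group[OF i', symmetric])
  also have "\<dots> \<le> (\<Sum>r\<in>?RS. N r * ?v + L1 (\<lambda>x. nu D i r x - mu x * N r))"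
  proof (rule sum_mono)
    fix r assume r: "r \<in> ?RS"
    have "(\<Sum>x\<in>Q. num r x) \<le> (\<Sum>x\<in>Q. N r * (mu x * h r x) + \<bar>nu D i r x - mu x * N r\<bar>)"
    proof (rule sum_mono)
      fix x
      have "(nu D i r x - mu x * N r) * h r x \<le> \<bar>nu D i r x - mu x * N r\<bar> * h r x"
        using h by (intro mult_right_mono) auto
      also have "\<dots> \<le> \<bar>nu D i r x - mu x * N r\<bar> * 1" using h by (intro mult_left_mono) auto
      finally show "num r x \<le> N r * (mu x * h r x) + \<bar>nu D i r x - mu x * N r\<bar>"
        unfolding h(3) by (simp add: algebra_simps)
    qed
    also have "\<dots> = N r * (\<Sum>x\<in>Q. mu x * h r x) + L1 (\<lambda>x. nu D i r x - mu x * N r)"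
      by (simp add: sum.distrib L1_def sum_distrib_left)
    finally show "(\<Sum>x\<in>Q. num r x) \<le> N r * ?v + L1 (\<lambda>x. nu D i r x - mu x * N r)"
      using fib[OF r] by simp
  qed
  also have "\<dots> = ?v + (\<Sum>r\<in>?RS. L1 (\<lambda>x. nu D i r x - mu x * N r))"
    using sum_nu[OF i', of D] by (simp add: sum.distrib N_def flip: sum_distrib_right)
  finally show ?thesis by (simp add: N_def)
qed

text \<open>A gain of \<open>\<delta>\<close> over the value forces an \<open>L1\<close> distance of
  at least \<open>\<delta>\<close> from the product law. \<open>L1_to_product_le\<close> reduces it
  to single-step errors, which Cauchy-Schwarz over the players and \<open>L1_nu_resample_le\<close>
  convert into divergences.\<close>

lemma gain_sq_le:
  assumes D: "\<And>l. l < n \<Longrightarrow> D l < k" and i: "i \<in> rounds"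
    and \<delta>: "0 \<le> \<delta>" "val k X A mu V + \<delta> \<le> win_on (insert i C) / win_on C"
  shows "(\<alpha> ^ k * \<delta>)\<^sup>2 \<le> 4 * real k * (\<Sum>t<k. kappa (D(i := t)) i)"
proof -
  let ?RS = "info_except D i ` Y"
  define B where "B = (\<lambda>t. \<Sum>r\<in>?RS. L1 (\<lambda>x. nu D i r x - resample t (nu D i r) x))"
  have i': "i < n" using i by simp
  have "\<alpha> ^ k * \<delta> \<le> \<alpha> ^ k * (\<Sum>r\<in>?RS. L1 (\<lambda>x. nu D i r x - mu x * sum (nu D i r) Q))"
    using win_insert_le[of D, OF D i] \<delta> alpha by (intro mult_left_mono) auto
  also have "\<dots> \<le> (\<Sum>r\<in>?RS. \<Sum>t<k. L1 (\<lambda>x. nu D i r x - resample t (nu D i r) x))"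
    by (subst sum_distrib_left) (intro sum_mono L1_to_product_le supported_nu i')
  also have "\<dots> = (\<Sum>t<k. B t)" unfolding B_def by (rule sum.swap)
  finally have "(\<alpha> ^ k * \<delta>)\<^sup>2 \<le> (\<Sum>t<k. B t)\<^sup>2"
    using \<delta> alpha by (intro power_mono) auto
  also have "\<dots> \<le> real k * (\<Sum>t<k. (B t)\<^sup>2)"
    using sum_squared_le_sum_of_squares[of B "{..<k}"] by (simp add: mult.commute)
  also have "\<dots> \<le> real k * (\<Sum>t<k. 4 * kappa (D(i := t)) i)"
    unfolding B_def using L1_nu_resample_le[OF i] by (intro mult_left_mono sum_mono) auto
  finally show ?thesis by (simp add: mult.assoc flip: sum_distrib_left)
qed

text \<open>The bounds for single rounds are summed over all choices \<open>D\<close> of hidden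
  players. Overwriting \<open>D i\<close> by a uniform player preserves the uniform law of
  \<open>D\<close>, so the sum over \<open>t\<close> amounts to a factor \<open>k\<close>, and
  \<open>sum_kappa_le\<close> bounds the sum over the rounds for each \<open>D\<close>.\<close>

lemma gain_bound:
  assumes \<delta>: "0 \<le> \<delta>" "\<And>i. i \<in> rounds \<Longrightarrow> val k X A mu V + \<delta> \<le> win_on (insert i C) / win_on C"
  shows "\<alpha> ^ (2 * k) * \<delta>\<^sup>2 * real (card rounds)
    \<le> 4 * (real k)\<^sup>2 * (ln (1 / win_on C) + real (card C) * ln (real (card (PiE {..<k} A))))"
proof -
  define \<Delta> where "\<Delta> = PiE {..<n} (\<lambda>_. {..<k})"
  let ?K = "ln (1 / win_on C) + real (card C) * ln (real (card (PiE {..<k} A)))"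
  have fin: "finite \<Delta>" unfolding \<Delta>_def by (intro finite_PiE) auto
  have D: "D l < k" if "D \<in> \<Delta>" "l < n" for D l using that by (auto simp: \<Delta>_def)
  have "card \<Delta> \<noteq> 0" using k_pos by (simp add: \<Delta>_def card_PiE)
  hence card: "0 < real (card \<Delta>)" by simp
  have shift: "(\<Sum>D\<in>\<Delta>. \<Sum>t<k. kappa (D(i := t)) i) = real k * (\<Sum>D\<in>\<Delta>. kappa D i)" if i: "i \<in> rounds" for i
  proof -
    \<comment> \<open>Exchanging \<open>t\<close> with the entry \<open>D i\<close> is an involution
      of \<open>\<Delta> \<times> {..<k}\<close>.\<close>
    let ?s = "\<lambda>(D, t). (D(i := t), D i :: nat)"
    have upd: "D(i := t) \<in> \<Delta>" if "D \<in> \<Delta>" "t < k" for D t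
      using that i by (auto simp: \<Delta>_def PiE_iff extensional_def)
    have "(\<Sum>D\<in>\<Delta>. \<Sum>t<k. kappa (D(i := t)) i) = (\<Sum>(D, t)\<in>\<Delta> \<times> {..<k}. kappa (D(i := t)) i)"
      by (rule sum.cartesian_product)
    also have "\<dots> = (\<Sum>(D, t)\<in>\<Delta> \<times> {..<k}. kappa D i)"
      using i D by (intro sum.reindex_bij_witness[of _ ?s ?s]) (auto simp: upd)
    also have "\<dots> = real k * (\<Sum>D\<in>\<Delta>. kappa D i)"
      by (simp add: sum_distrib_left flip: sum.cartesian_product)
    finally show ?thesis .
  qed
  have "real (card \<Delta>) * ((\<alpha> ^ k * \<delta>)\<^sup>2 * real (card rounds)) = (\<Sum>D\<in>\<Delta>. \<Sum>i\<in>rounds. (\<alpha> ^ k * \<delta>)\<^sup>2)"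
    by simp
  also have "\<dots> \<le> (\<Sum>D\<in>\<Delta>. \<Sum>i\<in>rounds. 4 * real k * (\<Sum>t<k. kappa (D(i := t)) i))"
    by (intro sum_mono gain_sq_le D \<delta>)
  also have "\<dots> = (\<Sum>i\<in>rounds. 4 * real k * (\<Sum>D\<in>\<Delta>. \<Sum>t<k. kappa (D(i := t)) i))"
    by (subst sum.swap) (simp add: sum_distrib_left)
  also have "\<dots> = (\<Sum>i\<in>rounds. 4 * (real k)\<^sup>2 * (\<Sum>D\<in>\<Delta>. kappa D i))"
    by (intro sum.cong refl) (simp add: shift power2_eq_square)
  also have "\<dots> = 4 * (real k)\<^sup>2 * (\<Sum>D\<in>\<Delta>. \<Sum>i\<in>rounds. kappa D i)"
    unfolding sum_distrib_left[symmetric] by (subst sum.swap) simp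
  also have "\<dots> \<le> 4 * (real k)\<^sup>2 * (\<Sum>D\<in>\<Delta>. ?K)"
    by (intro mult_left_mono sum_mono sum_kappa_le D) auto
  also have "\<dots> = real (card \<Delta>) * (4 * (real k)\<^sup>2 * ?K)" by simp
  finally have "(\<alpha> ^ k * \<delta>)\<^sup>2 * real (card rounds) \<le> 4 * (real k)\<^sup>2 * ?K"
    using card by (simp only: mult_le_cancel_left_pos)
  thus ?thesis by (simp add: power_mult_distrib power_mult mult.commute[of 2 k])
qed

end

section \<open>Exponential decay by conditioning on one more round at a time\<close>

context repeated_game
begin

text \<open>If the bound fails, every \<open>win_on C\<close> exceeds \<open>exp (- B)\<close>,
  which limits the entropy cost of conditioning. While \<open>card C < m\<close>,
  \<open>gain_bound\<close> with \<open>\<delta> = \<epsilon> / 2\<close> excludes that all other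
  rounds are won with conditional probability above \<open>1 - \<epsilon> / 2\<close>. Adding a bad
  round to \<open>C\<close> gains this factor, and \<open>m\<close> rounds bring
  \<open>win_on C\<close> down to at most \<open>exp (- B)\<close>.\<close>

lemma win_on_exp_bound:
  assumes \<epsilon>: "0 < \<epsilon>" "\<epsilon> \<le> 1" and v: "val k X A mu V \<le> 1 - \<epsilon>" and n: "0 < n"
    and s: "s = log 2 (real (card (PiE {..<k} A)))" "1 \<le> s"
  shows "win_on {..<n} \<le> exp (- (\<alpha> ^ (2 * k) * \<epsilon> ^ 3 * real n) / (384 * s * (real k)\<^sup>2))"
proof (rule ccontr)
  define \<tau> where "\<tau> = \<alpha> ^ (2 * k) * \<epsilon>\<^sup>2 * real n / (real k)\<^sup>2"
  define B where "B = \<tau> * \<epsilon> / (384 * s)"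
  assume "\<not> ?thesis"
  moreover have "- (\<alpha> ^ (2 * k) * \<epsilon> ^ 3 * real n) / (384 * s * (real k)\<^sup>2) = - B"
    by (simp add: B_def \<tau>_def power2_eq_square power3_eq_cube mult_ac)
  ultimately have gt: "exp (- B) < win_on {..<n}" by simp
  have \<tau>0: "0 < \<tau>" using alpha \<epsilon> n k_pos by (simp add: \<tau>_def)
  have "\<alpha> ^ (2 * k) * \<epsilon>\<^sup>2 * real n \<le> 1 * 1 * real n"
    using alpha \<epsilon> by (intro mult_mono) (auto simp: power_le_one)
  moreover have "1 \<le> (real k)\<^sup>2" using k_pos by simp
  ultimately have \<tau>n: "\<tau> \<le> real n"
    unfolding \<tau>_def using n by (subst divide_le_eq) (auto intro: order_trans[OF _ mult_left_mono])
  have B: "B \<le> \<tau> / 384"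
  proof -
    have "\<tau> * \<epsilon> \<le> \<tau> * s" using \<tau>0 \<epsilon> s by (intro mult_left_mono) auto
    thus ?thesis using s by (simp add: B_def field_simps)
  qed
  \<comment> \<open>The least \<open>m\<close> with \<open>m * \<epsilon> / 2 \<ge> B\<close>; the
    384 in \<open>B\<close> is twice the 192 here.\<close>
  define m where "m = nat \<lceil>\<tau> / (192 * s)\<rceil>"
  have m_ge: "\<tau> / (192 * s) \<le> real m" unfolding m_def by linarith
  have "\<exists>C. C \<subseteq> {..<n} \<and> card C = c \<and> win_on C \<le> (1 - \<epsilon> / 2) ^ c" if "c \<le> m" for c
    using that
  proof (induction c)
    case 0
    show ?case using win_on_empty_le_1 by (intro exI[of _ "{}"]) simp
  next
    case (Suc c)
    then obtain C where hC: "C \<subseteq> {..<n}" "card C = c" "win_on C \<le> (1 - \<epsilon> / 2) ^ c" by auto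
    \<comment> \<open>As \<open>Suc c \<le> m\<close> and \<open>m\<close> is rounded up,
      \<open>c\<close> lies strictly below the unrounded value.\<close>
    have c: "real c * s < \<tau> / 192"
    proof -
      have "real c < \<tau> / (192 * s)" using Suc.prems unfolding m_def by linarith
      thus ?thesis using s by (simp add: field_simps)
    qed
    have c_le: "real c \<le> real n / 192"
    proof -
      have "real c * 1 \<le> real c * s" using s by (intro mult_left_mono) auto
      thus ?thesis using c \<tau>n by simp
    qed
    have gtC: "exp (- B) < win_on C" using gt win_on_mono[OF hC(1)] by simp
    hence posC: "0 < win_on C" using exp_gt_zero[of "- B"] by linarith
    interpret conditioned_game k X A mu \<alpha> Xp V n f C
      using hC(1) posC by unfold_locales
    have "\<exists>i\<in>rounds. win_on (insert i C) \<le> (1 - \<epsilon> / 2) * win_on C"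
    proof (rule ccontr)
      assume *: "\<not> ?thesis"
      have "val k X A mu V + \<epsilon> / 2 \<le> win_on (insert i C) / win_on C" if "i \<in> rounds" for i
      proof -
        have "(1 - \<epsilon> / 2) \<le> win_on (insert i C) / win_on C"
          using * that posC by (force simp: field_simps)
        thus ?thesis using v by simp
      qed
      hence "\<alpha> ^ (2 * k) * (\<epsilon> / 2)\<^sup>2 * real (card rounds)
          \<le> 4 * (real k)\<^sup>2 * (ln (1 / win_on C) + real (card C) * ln (real (card (PiE {..<k} A))))"
        using \<epsilon> by (intro gain_bound) auto
      also have "\<dots> \<le> 4 * (real k)\<^sup>2 * (\<tau> / 384 + \<tau> / 192)"
      proof (intro mult_left_mono add_mono)
        have "ln (exp (- B)) \<le> ln (win_on C)" using gtC posC by (subst ln_le_cancel_iff) auto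
        thus "ln (1 / win_on C) \<le> \<tau> / 384" using posC B by (simp add: ln_div)
        have "ln (real (card (PiE {..<k} A))) = s * ln 2" using s(1) by (simp add: log_def)
        also have "\<dots> \<le> s * 1" using s(2) ln_2_less_1 by (intro mult_left_mono) auto
        finally have "real c * ln (real (card (PiE {..<k} A))) \<le> real c * s"
          by (intro mult_left_mono) auto
        thus "real (card C) * ln (real (card (PiE {..<k} A))) \<le> \<tau> / 192" using c hC(2) by simp
      qed auto
      also have "\<dots> = (real k)\<^sup>2 * \<tau> / 32" by simp
      also have "\<dots> = \<alpha> ^ (2 * k) * \<epsilon>\<^sup>2 * (real n / 32)" using k_pos by (simp add: \<tau>_def)
      finally have "\<alpha> ^ (2 * k) * \<epsilon>\<^sup>2 * (real (card rounds) / 4) \<le> \<alpha> ^ (2 * k) * \<epsilon>\<^sup>2 * (real n / 32)"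
        by (simp add: power_divide)
      \<comment> \<open>Here \<open>1 / 32\<close> is 4 times the sum of \<open>1 / 384\<close> and
        \<open>1 / 192\<close>. At most \<open>n / 8\<close> rounds would lie outside
        \<open>C\<close>, although \<open>C\<close> has at most \<open>n / 192\<close>
        elements.\<close>
      hence "real (card rounds) / 4 \<le> real n / 32"
        using alpha \<epsilon> by (subst (asm) mult_le_cancel_left_pos) auto
      moreover have "real (card rounds) = real n - real c"
        using hC(1,2) card_mono[OF _ hC(1)] by (simp add: card_Diff_subset finite_subset of_nat_diff)
      ultimately show False using c_le n by simp
    qed
    then obtain i where i: "i \<in> rounds" "win_on (insert i C) \<le> (1 - \<epsilon> / 2) * win_on C" by blast
    have "win_on (insert i C) \<le> (1 - \<epsilon> / 2) * (1 - \<epsilon> / 2) ^ c"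
      using i(2) hC(3) \<epsilon> by (intro order_trans[OF i(2)] mult_left_mono) auto
    moreover have "card (insert i C) = Suc c" using i hC by (auto simp: card_insert_if finite_subset)
    ultimately show ?case using i hC(1) by (intro exI[of _ "insert i C"]) auto
  qed
  then obtain C where C: "C \<subseteq> {..<n}" "win_on C \<le> (1 - \<epsilon> / 2) ^ m" by blast
  have "win_on {..<n} \<le> (1 - \<epsilon> / 2) ^ m" using win_on_mono[OF C(1)] C(2) by simp
  also have "\<dots> \<le> exp (- (\<epsilon> / 2)) ^ m"
    using \<epsilon> exp_ge_add_one_self[of "- (\<epsilon> / 2)"] by (intro power_mono) auto
  also have "\<dots> = exp (- (\<epsilon> / 2) * real m)" by (simp add: mult.commute flip: exp_of_nat_mult)
  also have "\<dots> \<le> exp (- B)"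
  proof -
    have "\<epsilon> / 2 * (\<tau> / (192 * s)) \<le> \<epsilon> / 2 * real m" using m_ge \<epsilon> by (intro mult_left_mono) auto
    thus ?thesis by (simp add: B_def mult.commute)
  qed
  finally show False using gt by simp
qed

end

theorem theorem4p1:
  fixes k :: nat and X :: "nat \<Rightarrow> 'q set" and A :: "nat \<Rightarrow> 'a set"
    and mu :: "(nat \<Rightarrow> 'q) \<Rightarrow> real" and V :: "(nat \<Rightarrow> 'q) \<Rightarrow> (nat \<Rightarrow> 'a) \<Rightarrow> bool"
    and \<alpha> \<epsilon> :: real and n :: nat
  assumes "0 < k"
    and "game k X A mu"
    and "anchored k X mu \<alpha>"
    and "val k X A mu V \<le> 1 - \<epsilon>"
    and "0 < n"
  shows "val_rep n k X A mu V
           \<le> exp (- (\<alpha> ^ (2 * k) * \<epsilon> ^ 3 * real n)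
                    / (384 * log 2 (real (card (PiE {..<k} A))) * (real k)\<^sup>2))"
proof -
  obtain Xp where Xp: "0 < \<alpha>" "\<alpha> \<le> 1" "\<forall>t<k. Xp t \<subseteq> X t"
    "\<forall>t<k. (\<Sum>x\<in>{x\<in>PiE {..<k} X. x t \<in> Xp t}. mu x) \<ge> \<alpha>"
    "\<forall>x\<in>PiE {..<k} X. mu x = marg k X mu ({..<k} - {t\<in>{..<k}. x t \<in> Xp t}) x
        * (\<Prod>t\<in>{t\<in>{..<k}. x t \<in> Xp t}. marg k X mu {t} x)"
    using assms(3) unfolding anchored_def Let_def by blast
  interpret anchored_game k X A mu \<alpha> Xp
    using assms(2) Xp by unfold_locales auto
  let ?a = "card (PiE {..<k} A)"
  let ?s = "log 2 (real ?a)"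
  have a: "1 \<le> ?a"
    using finite_A A_nonempty by (simp add: card_PiE Suc_le_eq prod_pos card_gt_0_iff)
  hence s0: "0 \<le> ?s" by simp
  have eps1: "\<epsilon> \<le> 1" using assms(4) val_nonneg[of V] by simp
  show ?thesis unfolding val_rep_def val_def
  proof (rule cSUP_least)
    show "strategies k (rep_Q n X) (rep_A n A) \<noteq> {}"
      using A_nonempty by (auto simp: strategies_def rep_A_def PiE_eq_empty_iff)
  next
    fix f assume f: "f \<in> strategies k (rep_Q n X) (rep_A n A)"
    interpret repeated_game k X A mu \<alpha> Xp V n f
      using assms(1) f by unfold_locales
    have "win_on {..<n} \<le> exp (- (\<alpha> ^ (2 * k) * \<epsilon> ^ 3 * real n) / (384 * ?s * (real k)\<^sup>2))"
    proof (cases "0 < \<epsilon> \<and> 2 \<le> ?a")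
      case True
      hence "log 2 2 \<le> ?s" by (subst log_le_cancel_iff) auto
      thus ?thesis using True eps1 assms by (intro win_on_exp_bound) auto
    next
      case False
      \<comment> \<open>The degenerate cases make the bound at least 1: for
        \<open>\<epsilon> \<le> 0\<close> the exponent is nonnegative, and for a single answer tuple
        the logarithm is 0 and division by zero makes the exponent 0.\<close>
      have "0 \<le> - (\<alpha> ^ (2 * k) * \<epsilon> ^ 3 * real n) / (384 * ?s * (real k)\<^sup>2)"
      proof (cases "0 < \<epsilon>")
        case True
        hence "?a = 1" using False a by simp
        thus ?thesis by simp
      next
        case False
        hence "\<epsilon> ^ 3 \<le> 0" by simp
        hence "\<alpha> ^ (2 * k) * \<epsilon> ^ 3 * real n \<le> 0" using Xp(1) by (simp add: mult_nonneg_nonpos mult_nonpos_nonneg)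
        thus ?thesis using s0 by (intro divide_nonneg_nonneg) auto
      qed
      hence "1 \<le> exp (- (\<alpha> ^ (2 * k) * \<epsilon> ^ 3 * real n) / (384 * ?s * (real k)\<^sup>2))" by simp
      thus ?thesis using win_on_mono[OF empty_subsetI, of "{..<n}"] win_on_empty_le_1 by linarith
    qed
    thus "win_prob k (rep_Q n X) (rep_mu n k X mu) (rep_V n k V) f
        \<le> exp (- (\<alpha> ^ (2 * k) * \<epsilon> ^ 3 * real n) / (384 * ?s * (real k)\<^sup>2))"
      by (simp only: win_prob_rep)
  qed
qed

end
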